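(* Let $\mathcal C$ and $\mathcal D$ be autonomous categories and let $(F,f_2,f_0):\mathcal C\to\mathcal D$ be an autonomous monoidal functor, with natural isomorphism $\kappa_X: SFX\to FSX$. Then there is a comonoidal structure $(F,F_2,F_0)$ on $F$ such that $(F,f_2,f_0,F_2,F_0):\mathcal C\to\mathcal D$ is a Frobenius monoidal functor.
   Context: Monoidal categories have tensor product $\otimes$ and unit $I$; associativity and unit constraints are suppressed (written as if strict), and identity morphisms are written $1$. Duals. A left dual of $X$ is an object $SX$ with arrows $\mathsf d_X:I\to X\otimes SX$, $\mathsf e_X:SX\otimes X\to I$ such that $(1\otimes \mathsf e_X)(\mathsf d_X\otimes 1)=1_X$ and $(\mathsf e_X\otimes 1)(1\otimes \mathsf d_X)=1_{SX}$. A right dual of $X$ is an object $S'X$ with arrows $\mathsf d'_X:I\to S'X\otimes X$, $\mathsf e'_X:X\otimes S'X\to I$ such that $(\mathsf e'_X\otimes 1)(1\otimes \mathsf d'_X)=1_X$ and $(1\otimes\mathsf e'_X)(\mathsf d'_X\otimes 1)=1_{S'X}$. A category is left (right) autonomous if it is monoidal and every object has a left (right) dual, and autonomous if both; a choice of duals is assumed. For $f:X\to Y$, $Sf=(\mathsf e_Y\otimes 1)(1\otimes f\otimes 1)(1\otimes\mathsf d_X):SY\to SX$, which makes $S$ a contravariant functor; similarly for $S'$. Functors. A monoidal functor $(F,f_2,f_0)$ is a functor with a natural transformation $f_2:FX\otimes FY\to F(X\otimes Y)$ and a morphism $f_0:I\to FI$ (not necessarily invertible) satisfying the usual associativity and unit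 axioms. A comonoidal functor $(F,F_2,F_0)$ is the dual notion, with $F_2:F(X\otimes Y)\to FX\otimes FY$ and $F_0:FI\to I$. A Frobenius monoidal functor $(F,f_2,f_0,F_2,F_0)$ is a functor that is monoidal via $(f_2,f_0)$, comonoidal via $(F_2,F_0)$, and satisfies, for all $X,Y,Z$, $$F_2\circ f_2=(f_2\otimes 1)\circ(1\otimes F_2):FX\otimes F(Y\otimes Z)\to F(X\otimes Y)\otimes FZ,$$ $$F_2\circ f_2=(1\otimes f_2)\circ(F_2\otimes 1):F(X\otimes Y)\otimes FZ\to FX\otimes F(Y\otimes Z).$$ Autonomous functors. A monoidal functor $F:\mathcal C\to\mathcal D$ between left autonomous categories is (left) autonomous if there is a natural isomorphism $\kappa_X:SFX\to FSX$ such that for all $X$ $$f_2\circ(1\otimes\kappa_X)\circ\mathsf d_{FX}=F(\mathsf d_X)\circ f_0: I\to F(X\otimes SX),$$ $$F(\mathsf e_X)\circ f_2\circ(\kappa_X\otimes 1)=f_0\circ\mathsf e_{FX}:SFX\otimes FX\to FI.$$ *)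

theory Defs
  imports Main
begin

section \<open>Categories and functors\<close>

record ('o, 'm) category =
  obj :: "'o set"
  arr :: "'m set"
  src :: "'m \<Rightarrow> 'o"
  tgt :: "'m \<Rightarrow> 'o"
  idn :: "'o \<Rightarrow> 'm"  (\<open>\<one>\<index>\<close>)
  cmp :: "'m \<Rightarrow> 'm \<Rightarrow> 'm"  (infixr \<open>\<cdot>\<index>\<close> 55)

definition hom :: "('o, 'm, 'x) category_scheme \<Rightarrow> 'o \<Rightarrow> 'o \<Rightarrow> 'm set" where
  "hom C X Y = {f \<in> arr C. src C f = X \<and> tgt C f = Y}"

locale category =
  fixes C :: "('o, 'm, 'x) category_scheme" (structure)
  assumes src_obj: "f \<in> arr C \<Longrightarrow> src C f \<in> obj C"
    and tgt_obj: "f \<in> arr C \<Longrightarrow> tgt C f \<in> obj C"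
    and idn_hom: "X \<in> obj C \<Longrightarrow> \<one> X \<in> hom C X X"
    and cmp_hom: "\<lbrakk>f \<in> hom C X Y; g \<in> hom C Y Z\<rbrakk> \<Longrightarrow> g \<cdot> f \<in> hom C X Z"
    and cmp_idn: "f \<in> hom C X Y \<Longrightarrow> f \<cdot> \<one> X = f"
    and idn_cmp: "f \<in> hom C X Y \<Longrightarrow> \<one> Y \<cdot> f = f"
    and cmp_assoc:
      "\<lbrakk>f \<in> hom C W X; g \<in> hom C X Y; h \<in> hom C Y Z\<rbrakk> \<Longrightarrow> (h \<cdot> g) \<cdot> f = h \<cdot> (g \<cdot> f)"

definition inverse_arrows :: "('o, 'm, 'x) category_scheme \<Rightarrow> 'm \<Rightarrow> 'm \<Rightarrow> bool" where
  "inverse_arrows C f g \<longleftrightarrow>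
     f \<in> arr C \<and> g \<in> hom C (tgt C f) (src C f) \<and>
     g \<cdot>\<^bsub>C\<^esub> f = \<one>\<^bsub>C\<^esub> (src C f) \<and> f \<cdot>\<^bsub>C\<^esub> g = \<one>\<^bsub>C\<^esub> (tgt C f)"

definition iso :: "('o, 'm, 'x) category_scheme \<Rightarrow> 'o \<Rightarrow> 'o \<Rightarrow> 'm set" where
  "iso C X Y = {f \<in> hom C X Y. \<exists>g. inverse_arrows C f g}"

definition inv_arr :: "('o, 'm, 'x) category_scheme \<Rightarrow> 'm \<Rightarrow> 'm" where
  "inv_arr C f = (THE g. inverse_arrows C f g)"

record ('o, 'm, 'p, 'n) cat_functor =
  omap :: "'o \<Rightarrow> 'p"
  amap :: "'m \<Rightarrow> 'n"

locale cat_functor = C: category C + D: category D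
  for C :: "('o, 'm, 'x) category_scheme"
    and D :: "('p, 'n, 'y) category_scheme" +
  fixes F :: "('o, 'm, 'p, 'n) cat_functor"
  assumes omap_obj: "X \<in> obj C \<Longrightarrow> omap F X \<in> obj D"
    and amap_hom: "f \<in> hom C X Y \<Longrightarrow> amap F f \<in> hom D (omap F X) (omap F Y)"
    and amap_idn: "X \<in> obj C \<Longrightarrow> amap F (\<one>\<^bsub>C\<^esub> X) = \<one>\<^bsub>D\<^esub> (omap F X)"
    and amap_cmp:
      "\<lbrakk>f \<in> hom C X Y; g \<in> hom C Y Z\<rbrakk>
        \<Longrightarrow> amap F (g \<cdot>\<^bsub>C\<^esub> f) = amap F g \<cdot>\<^bsub>D\<^esub> amap F f"

section \<open>Monoidal categories\<close>

text \<open>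
  The monoidal categories are not assumed strict. The orientation of the constraints is
  \<open>\<alpha> X Y Z : (X \<odot> Y) \<odot> Z \<rightarrow> X \<odot> (Y \<odot> Z)\<close>, \<open>\<l> X : I \<odot> X \<rightarrow> X\<close> and
  \<open>\<r> X : X \<odot> I \<rightarrow> X\<close>. The tensor product is written \<open>\<odot>\<close> on objects and
  \<open>\<otimes>\<close> on arrows. Equations usually written as if in a strict category have the
  constraints inserted explicitly below.
\<close>

record ('o, 'm) monoidal_category = "('o, 'm) category" +
  tensor_obj :: "'o \<Rightarrow> 'o \<Rightarrow> 'o"  (infixr \<open>\<odot>\<index>\<close> 70)
  tensor_arr :: "'m \<Rightarrow> 'm \<Rightarrow> 'm"  (infixr \<open>\<otimes>\<index>\<close> 70)
  unit_obj :: "'o"  (\<open>\<I>\<index>\<close>)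
  assoc :: "'o \<Rightarrow> 'o \<Rightarrow> 'o \<Rightarrow> 'm"  (\<open>\<alpha>\<index>\<close>)
  lunit :: "'o \<Rightarrow> 'm"  (\<open>\<l>\<index>\<close>)
  runit :: "'o \<Rightarrow> 'm"  (\<open>\<r>\<index>\<close>)

locale monoidal_category = category C
  for C :: "('o, 'm, 'x) monoidal_category_scheme" (structure) +
  assumes tensor_obj_obj: "\<lbrakk>X \<in> obj C; Y \<in> obj C\<rbrakk> \<Longrightarrow> X \<odot> Y \<in> obj C"
    and unit_obj_obj: "\<I> \<in> obj C"
    and tensor_hom:
      "\<lbrakk>f \<in> hom C X Y; f' \<in> hom C X' Y'\<rbrakk> \<Longrightarrow> f \<otimes> f' \<in> hom C (X \<odot> X') (Y \<odot> Y')"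
    and tensor_idn: "\<lbrakk>X \<in> obj C; Y \<in> obj C\<rbrakk> \<Longrightarrow> \<one> X \<otimes> \<one> Y = \<one> (X \<odot> Y)"
    and tensor_cmp:
      "\<lbrakk>f \<in> hom C X Y; g \<in> hom C Y Z; f' \<in> hom C X' Y'; g' \<in> hom C Y' Z'\<rbrakk>
        \<Longrightarrow> (g \<cdot> f) \<otimes> (g' \<cdot> f') = (g \<otimes> g') \<cdot> (f \<otimes> f')"
    and assoc_iso:
      "\<lbrakk>X \<in> obj C; Y \<in> obj C; Z \<in> obj C\<rbrakk>
        \<Longrightarrow> \<alpha> X Y Z \<in> iso C ((X \<odot> Y) \<odot> Z) (X \<odot> (Y \<odot> Z))"
    and assoc_natural:
      "\<lbrakk>f \<in> hom C X X'; g \<in> hom C Y Y'; h \<in> hom C Z Z'\<rbrakk>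
        \<Longrightarrow> \<alpha> X' Y' Z' \<cdot> ((f \<otimes> g) \<otimes> h) = (f \<otimes> (g \<otimes> h)) \<cdot> \<alpha> X Y Z"
    and lunit_iso: "X \<in> obj C \<Longrightarrow> \<l> X \<in> iso C (\<I> \<odot> X) X"
    and lunit_natural: "f \<in> hom C X Y \<Longrightarrow> \<l> Y \<cdot> (\<one> \<I> \<otimes> f) = f \<cdot> \<l> X"
    and runit_iso: "X \<in> obj C \<Longrightarrow> \<r> X \<in> iso C (X \<odot> \<I>) X"
    and runit_natural: "f \<in> hom C X Y \<Longrightarrow> \<r> Y \<cdot> (f \<otimes> \<one> \<I>) = f \<cdot> \<r> X"
    and pentagon:
      "\<lbrakk>W \<in> obj C; X \<in> obj C; Y \<in> obj C; Z \<in> obj C\<rbrakk>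
        \<Longrightarrow> (\<one> W \<otimes> \<alpha> X Y Z) \<cdot> \<alpha> W (X \<odot> Y) Z \<cdot> (\<alpha> W X Y \<otimes> \<one> Z)
            = \<alpha> W X (Y \<odot> Z) \<cdot> \<alpha> (W \<odot> X) Y Z"
    and triangle:
      "\<lbrakk>X \<in> obj C; Y \<in> obj C\<rbrakk>
        \<Longrightarrow> (\<one> X \<otimes> \<l> Y) \<cdot> \<alpha> X \<I> Y = \<r> X \<otimes> \<one> Y"

section \<open>Duals\<close>

definition left_dual ::
  "('o, 'm, 'x) monoidal_category_scheme \<Rightarrow> 'o \<Rightarrow> 'o \<Rightarrow> 'm \<Rightarrow> 'm \<Rightarrow> bool" where
  "left_dual C X SX d e \<longleftrightarrow>
     X \<in> obj C \<and> SX \<in> obj C \<and>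
     d \<in> hom C \<I>\<^bsub>C\<^esub> (X \<odot>\<^bsub>C\<^esub> SX) \<and> e \<in> hom C (SX \<odot>\<^bsub>C\<^esub> X) \<I>\<^bsub>C\<^esub> \<and>
     \<r>\<^bsub>C\<^esub> X \<cdot>\<^bsub>C\<^esub> (\<one>\<^bsub>C\<^esub> X \<otimes>\<^bsub>C\<^esub> e) \<cdot>\<^bsub>C\<^esub> \<alpha>\<^bsub>C\<^esub> X SX X
       \<cdot>\<^bsub>C\<^esub> (d \<otimes>\<^bsub>C\<^esub> \<one>\<^bsub>C\<^esub> X) \<cdot>\<^bsub>C\<^esub> inv_arr C (\<l>\<^bsub>C\<^esub> X) = \<one>\<^bsub>C\<^esub> X \<and>
     \<l>\<^bsub>C\<^esub> SX \<cdot>\<^bsub>C\<^esub> (e \<otimes>\<^bsub>C\<^esub> \<one>\<^bsub>C\<^esub> SX) \<cdot>\<^bsub>C\<^esub> inv_arr C (\<alpha>\<^bsub>C\<^esub> SX X SX)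
       \<cdot>\<^bsub>C\<^esub> (\<one>\<^bsub>C\<^esub> SX \<otimes>\<^bsub>C\<^esub> d) \<cdot>\<^bsub>C\<^esub> inv_arr C (\<r>\<^bsub>C\<^esub> SX) = \<one>\<^bsub>C\<^esub> SX"

definition right_dual ::
  "('o, 'm, 'x) monoidal_category_scheme \<Rightarrow> 'o \<Rightarrow> 'o \<Rightarrow> 'm \<Rightarrow> 'm \<Rightarrow> bool" where
  "right_dual C X S'X d' e' \<longleftrightarrow>
     X \<in> obj C \<and> S'X \<in> obj C \<and>
     d' \<in> hom C \<I>\<^bsub>C\<^esub> (S'X \<odot>\<^bsub>C\<^esub> X) \<and> e' \<in> hom C (X \<odot>\<^bsub>C\<^esub> S'X) \<I>\<^bsub>C\<^esub> \<and>
     \<l>\<^bsub>C\<^esub> X \<cdot>\<^bsub>C\<^esub> (e' \<otimes>\<^bsub>C\<^esub> \<one>\<^bsub>C\<^esub> X) \<cdot>\<^bsub>C\<^esub> inv_arr C (\<alpha>\<^bsub>C\<^esub> X S'X X)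
       \<cdot>\<^bsub>C\<^esub> (\<one>\<^bsub>C\<^esub> X \<otimes>\<^bsub>C\<^esub> d') \<cdot>\<^bsub>C\<^esub> inv_arr C (\<r>\<^bsub>C\<^esub> X) = \<one>\<^bsub>C\<^esub> X \<and>
     \<r>\<^bsub>C\<^esub> S'X \<cdot>\<^bsub>C\<^esub> (\<one>\<^bsub>C\<^esub> S'X \<otimes>\<^bsub>C\<^esub> e') \<cdot>\<^bsub>C\<^esub> \<alpha>\<^bsub>C\<^esub> S'X X S'X
       \<cdot>\<^bsub>C\<^esub> (d' \<otimes>\<^bsub>C\<^esub> \<one>\<^bsub>C\<^esub> S'X) \<cdot>\<^bsub>C\<^esub> inv_arr C (\<l>\<^bsub>C\<^esub> S'X) = \<one>\<^bsub>C\<^esub> S'X"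

record ('o, 'm) left_autonomous_category = "('o, 'm) monoidal_category" +
  ldual :: "'o \<Rightarrow> 'o"
  ldual_d :: "'o \<Rightarrow> 'm"
  ldual_e :: "'o \<Rightarrow> 'm"

locale left_autonomous_category = monoidal_category C
  for C :: "('o, 'm, 'x) left_autonomous_category_scheme" (structure) +
  assumes left_dual: "X \<in> obj C \<Longrightarrow> left_dual C X (ldual C X) (ldual_d C X) (ldual_e C X)"

record ('o, 'm) autonomous_category = "('o, 'm) left_autonomous_category" +
  rdual :: "'o \<Rightarrow> 'o"
  rdual_d :: "'o \<Rightarrow> 'm"
  rdual_e :: "'o \<Rightarrow> 'm"

locale autonomous_category = left_autonomous_category C
  for C :: "('o, 'm, 'x) autonomous_category_scheme" (structure) +
  assumes right_dual: "X \<in> obj C \<Longrightarrow> right_dual C X (rdual C X) (rdual_d C X) (rdual_e C X)"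

definition ldual_arr :: "('o, 'm, 'x) left_autonomous_category_scheme \<Rightarrow> 'm \<Rightarrow> 'm" where
  "ldual_arr C f =
     (let X = src C f; Y = tgt C f; SX = ldual C X; SY = ldual C Y in
       \<l>\<^bsub>C\<^esub> SX \<cdot>\<^bsub>C\<^esub> (ldual_e C Y \<otimes>\<^bsub>C\<^esub> \<one>\<^bsub>C\<^esub> SX)
         \<cdot>\<^bsub>C\<^esub> inv_arr C (\<alpha>\<^bsub>C\<^esub> SY Y SX)
         \<cdot>\<^bsub>C\<^esub> (\<one>\<^bsub>C\<^esub> SY \<otimes>\<^bsub>C\<^esub> (f \<otimes>\<^bsub>C\<^esub> \<one>\<^bsub>C\<^esub> SX))
         \<cdot>\<^bsub>C\<^esub> (\<one>\<^bsub>C\<^esub> SY \<otimes>\<^bsub>C\<^esub> ldual_d C X) \<cdot>\<^bsub>C\<^esub> inv_arr C (\<r>\<^bsub>C\<^esub> SY))"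

section \<open>Monoidal, comonoidal, Frobenius monoidal and autonomous functors\<close>

locale monoidal_functor =
  C: monoidal_category C + D: monoidal_category D + cat_functor C D F
  for C :: "('o, 'm, 'x) monoidal_category_scheme"
    and D :: "('p, 'n, 'y) monoidal_category_scheme"
    and F :: "('o, 'm, 'p, 'n) cat_functor" +
  fixes f2 :: "'o \<Rightarrow> 'o \<Rightarrow> 'n" and f0 :: 'n
  assumes f2_hom:
      "\<lbrakk>X \<in> obj C; Y \<in> obj C\<rbrakk>
        \<Longrightarrow> f2 X Y \<in> hom D (omap F X \<odot>\<^bsub>D\<^esub> omap F Y) (omap F (X \<odot>\<^bsub>C\<^esub> Y))"
    and f2_natural:
      "\<lbrakk>f \<in> hom C X X'; g \<in> hom C Y Y'\<rbrakk>
        \<Longrightarrow> f2 X' Y' \<cdot>\<^bsub>D\<^esub> (amap F f \<otimes>\<^bsub>D\<^esub> amap F g)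
            = amap F (f \<otimes>\<^bsub>C\<^esub> g) \<cdot>\<^bsub>D\<^esub> f2 X Y"
    and f0_hom: "f0 \<in> hom D \<I>\<^bsub>D\<^esub> (omap F \<I>\<^bsub>C\<^esub>)"
    and f2_assoc:
      "\<lbrakk>X \<in> obj C; Y \<in> obj C; Z \<in> obj C\<rbrakk>
        \<Longrightarrow> amap F (\<alpha>\<^bsub>C\<^esub> X Y Z) \<cdot>\<^bsub>D\<^esub> f2 (X \<odot>\<^bsub>C\<^esub> Y) Z
              \<cdot>\<^bsub>D\<^esub> (f2 X Y \<otimes>\<^bsub>D\<^esub> \<one>\<^bsub>D\<^esub> (omap F Z))
            = f2 X (Y \<odot>\<^bsub>C\<^esub> Z) \<cdot>\<^bsub>D\<^esub> (\<one>\<^bsub>D\<^esub> (omap F X) \<otimes>\<^bsub>D\<^esub> f2 Y Z)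
              \<cdot>\<^bsub>D\<^esub> \<alpha>\<^bsub>D\<^esub> (omap F X) (omap F Y) (omap F Z)"
    and f0_lunit:
      "X \<in> obj C
        \<Longrightarrow> amap F (\<l>\<^bsub>C\<^esub> X) \<cdot>\<^bsub>D\<^esub> f2 \<I>\<^bsub>C\<^esub> X \<cdot>\<^bsub>D\<^esub> (f0 \<otimes>\<^bsub>D\<^esub> \<one>\<^bsub>D\<^esub> (omap F X))
            = \<l>\<^bsub>D\<^esub> (omap F X)"
    and f0_runit:
      "X \<in> obj C
        \<Longrightarrow> amap F (\<r>\<^bsub>C\<^esub> X) \<cdot>\<^bsub>D\<^esub> f2 X \<I>\<^bsub>C\<^esub> \<cdot>\<^bsub>D\<^esub> (\<one>\<^bsub>D\<^esub> (omap F X) \<otimes>\<^bsub>D\<^esub> f0)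
            = \<r>\<^bsub>D\<^esub> (omap F X)"

locale comonoidal_functor =
  C: monoidal_category C + D: monoidal_category D + cat_functor C D F
  for C :: "('o, 'm, 'x) monoidal_category_scheme"
    and D :: "('p, 'n, 'y) monoidal_category_scheme"
    and F :: "('o, 'm, 'p, 'n) cat_functor" +
  fixes F2 :: "'o \<Rightarrow> 'o \<Rightarrow> 'n" and F0 :: 'n
  assumes F2_hom:
      "\<lbrakk>X \<in> obj C; Y \<in> obj C\<rbrakk>
        \<Longrightarrow> F2 X Y \<in> hom D (omap F (X \<odot>\<^bsub>C\<^esub> Y)) (omap F X \<odot>\<^bsub>D\<^esub> omap F Y)"
    and F2_natural:
      "\<lbrakk>f \<in> hom C X X'; g \<in> hom C Y Y'\<rbrakk>
        \<Longrightarrow> F2 X' Y' \<cdot>\<^bsub>D\<^esub> amap F (f \<otimes>\<^bsub>C\<^esub> g)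
            = (amap F f \<otimes>\<^bsub>D\<^esub> amap F g) \<cdot>\<^bsub>D\<^esub> F2 X Y"
    and F0_hom: "F0 \<in> hom D (omap F \<I>\<^bsub>C\<^esub>) \<I>\<^bsub>D\<^esub>"
    and F2_coassoc:
      "\<lbrakk>X \<in> obj C; Y \<in> obj C; Z \<in> obj C\<rbrakk>
        \<Longrightarrow> \<alpha>\<^bsub>D\<^esub> (omap F X) (omap F Y) (omap F Z)
              \<cdot>\<^bsub>D\<^esub> (F2 X Y \<otimes>\<^bsub>D\<^esub> \<one>\<^bsub>D\<^esub> (omap F Z)) \<cdot>\<^bsub>D\<^esub> F2 (X \<odot>\<^bsub>C\<^esub> Y) Z
            = (\<one>\<^bsub>D\<^esub> (omap F X) \<otimes>\<^bsub>D\<^esub> F2 Y Z) \<cdot>\<^bsub>D\<^esub> F2 X (Y \<odot>\<^bsub>C\<^esub> Z)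
              \<cdot>\<^bsub>D\<^esub> amap F (\<alpha>\<^bsub>C\<^esub> X Y Z)"
    and F0_lcounit:
      "X \<in> obj C
        \<Longrightarrow> \<l>\<^bsub>D\<^esub> (omap F X) \<cdot>\<^bsub>D\<^esub> (F0 \<otimes>\<^bsub>D\<^esub> \<one>\<^bsub>D\<^esub> (omap F X)) \<cdot>\<^bsub>D\<^esub> F2 \<I>\<^bsub>C\<^esub> X
            = amap F (\<l>\<^bsub>C\<^esub> X)"
    and F0_rcounit:
      "X \<in> obj C
        \<Longrightarrow> \<r>\<^bsub>D\<^esub> (omap F X) \<cdot>\<^bsub>D\<^esub> (\<one>\<^bsub>D\<^esub> (omap F X) \<otimes>\<^bsub>D\<^esub> F0) \<cdot>\<^bsub>D\<^esub> F2 X \<I>\<^bsub>C\<^esub>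
            = amap F (\<r>\<^bsub>C\<^esub> X)"

locale frobenius_monoidal_functor =
  monoidal_functor C D F f2 f0 + comonoidal_functor C D F F2 F0
  for C :: "('o, 'm, 'x) monoidal_category_scheme"
    and D :: "('p, 'n, 'y) monoidal_category_scheme"
    and F :: "('o, 'm, 'p, 'n) cat_functor"
    and f2 f0 F2 F0 +
  assumes frobenius_left:
      "\<lbrakk>X \<in> obj C; Y \<in> obj C; Z \<in> obj C\<rbrakk>
        \<Longrightarrow> F2 (X \<odot>\<^bsub>C\<^esub> Y) Z \<cdot>\<^bsub>D\<^esub> amap F (inv_arr C (\<alpha>\<^bsub>C\<^esub> X Y Z))
              \<cdot>\<^bsub>D\<^esub> f2 X (Y \<odot>\<^bsub>C\<^esub> Z)
            = (f2 X Y \<otimes>\<^bsub>D\<^esub> \<one>\<^bsub>D\<^esub> (omap F Z))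
              \<cdot>\<^bsub>D\<^esub> inv_arr D (\<alpha>\<^bsub>D\<^esub> (omap F X) (omap F Y) (omap F Z))
              \<cdot>\<^bsub>D\<^esub> (\<one>\<^bsub>D\<^esub> (omap F X) \<otimes>\<^bsub>D\<^esub> F2 Y Z)"
    and frobenius_right:
      "\<lbrakk>X \<in> obj C; Y \<in> obj C; Z \<in> obj C\<rbrakk>
        \<Longrightarrow> F2 X (Y \<odot>\<^bsub>C\<^esub> Z) \<cdot>\<^bsub>D\<^esub> amap F (\<alpha>\<^bsub>C\<^esub> X Y Z) \<cdot>\<^bsub>D\<^esub> f2 (X \<odot>\<^bsub>C\<^esub> Y) Z
            = (\<one>\<^bsub>D\<^esub> (omap F X) \<otimes>\<^bsub>D\<^esub> f2 Y Z)
              \<cdot>\<^bsub>D\<^esub> \<alpha>\<^bsub>D\<^esub> (omap F X) (omap F Y) (omap F Z)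
              \<cdot>\<^bsub>D\<^esub> (F2 X Y \<otimes>\<^bsub>D\<^esub> \<one>\<^bsub>D\<^esub> (omap F Z))"

text \<open>
  The family \<open>\<kappa>\<close> is a natural isomorphism between contravariant functors, so its
  naturality square at \<open>f : X \<rightarrow> Y\<close> runs from \<open>SFY\<close> to \<open>FSX\<close>.
\<close>

locale autonomous_functor =
  C: left_autonomous_category C + D: left_autonomous_category D + monoidal_functor C D F f2 f0
  for C :: "('o, 'm, 'x) left_autonomous_category_scheme"
    and D :: "('p, 'n, 'y) left_autonomous_category_scheme"
    and F :: "('o, 'm, 'p, 'n) cat_functor"
    and f2 f0 +
  fixes \<kappa> :: "'o \<Rightarrow> 'n"
  assumes kappa_iso:
      "X \<in> obj C \<Longrightarrow> \<kappa> X \<in> iso D (ldual D (omap F X)) (omap F (ldual C X))"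
    and kappa_natural:
      "f \<in> hom C X Y
        \<Longrightarrow> \<kappa> X \<cdot>\<^bsub>D\<^esub> ldual_arr D (amap F f) = amap F (ldual_arr C f) \<cdot>\<^bsub>D\<^esub> \<kappa> Y"
    and kappa_d:
      "X \<in> obj C
        \<Longrightarrow> f2 X (ldual C X) \<cdot>\<^bsub>D\<^esub> (\<one>\<^bsub>D\<^esub> (omap F X) \<otimes>\<^bsub>D\<^esub> \<kappa> X) \<cdot>\<^bsub>D\<^esub> ldual_d D (omap F X)
            = amap F (ldual_d C X) \<cdot>\<^bsub>D\<^esub> f0"
    and kappa_e:
      "X \<in> obj C
        \<Longrightarrow> amap F (ldual_e C X) \<cdot>\<^bsub>D\<^esub> f2 (ldual C X) X \<cdot>\<^bsub>D\<^esub> (\<kappa> X \<otimes>\<^bsub>D\<^esub> \<one>\<^bsub>D\<^esub> (omap F X))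
            = f0 \<cdot>\<^bsub>D\<^esub> ldual_e D (omap F X)"

end

theory Submission imports Defs begin

text \<open>
  A monoidal functor that preserves duals in the sense of \<open>\<kappa>\<close> has invertible constraints
  \<open>f2\<close>, and \<open>f0\<close> has a section; the comonoidal structure consists of the inverses
  \<open>F2 = f2\<inverse>\<close> and of a section \<open>F0\<close> of \<open>f0\<close>.

  Strictly written, the candidate for \<open>F2 X Y\<close> creates a copy of \<open>FX \<odot> SFX\<close> on the left and lets
  \<open>F\<close> absorb \<open>X\<close> against its dual:
  \<open>F(X \<odot> Y) \<rightarrow> FX \<odot> SFX \<odot> F(X \<odot> Y) \<rightarrow> FX \<odot> FSX \<odot> F(X \<odot> Y) \<rightarrow> FX \<odot> F(SX \<odot> X \<odot> Y) \<rightarrow> FX \<odot> FY\<close>,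
  by \<open>d\<close>, \<open>\<kappa>\<close>, \<open>f2\<close> and \<open>F(e)\<close>. If it is followed by \<open>f2\<close>, the axiom relating \<open>\<kappa>\<close> to \<open>d\<close> turns
  \<open>f2 \<cdot> \<kappa> \<cdot> d\<close> into \<open>F d \<cdot> f0\<close>, so that the composite becomes the image under \<open>F\<close> of a zigzag in
  \<open>C\<close>, which is an identity (\<open>f2_coev_tensor\<close>). If it is preceded by \<open>f2\<close>, the axiom relating
  \<open>\<kappa>\<close> to \<open>e\<close> turns \<open>F e \<cdot> f2 \<cdot> \<kappa>\<close> into \<open>f0 \<cdot> e\<close>, and the composite becomes a zigzag in \<open>D\<close>
  (\<open>f2_ev_tensor\<close>). Both are instances of the lemma \<open>zigzag\<close>, and together they give
  \<open>f2_invertible\<close>.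

  For \<open>F0\<close>, the second axiom at \<open>X = I\<close> says that \<open>F e \<cdot> f2 \<cdot> \<kappa>\<close> factors through \<open>f0\<close>. Since \<open>e\<close>
  is split by \<open>d\<close> over the unit object (\<open>unit_dual_retract\<close>) and \<open>f2\<close> is unital, that arrow has a
  section, hence so has \<open>f0\<close> (\<open>f0_split_epi\<close>). The arrow \<open>f0\<close> itself need not be invertible: the
  zero functor into an additive autonomous category with \<open>I \<noteq> 0\<close> is an example.

  Once \<open>f2\<close> is invertible, the Frobenius equations and coassociativity are rearrangements of the
  associativity axiom for \<open>f2\<close>, and the counit laws follow from the unit laws by cancelling
  \<open>f0 \<cdot> F0 = 1\<close> (\<open>frobenius_of_invertible\<close>).

  As the categories are not strict, the zigzag needs the coherence facts
  \<open>\<l> (X \<odot> Y) \<cdot> \<alpha> I X Y = \<l> X \<otimes> 1\<close> and \<open>\<l> I = \<r> I\<close>, which Kelly derived from the pentagon and the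
  triangle.
\<close>

section \<open>Calculating with arrows\<close>

context category
begin

lemma idn_arr [simp]: "X \<in> obj C \<Longrightarrow> \<one> X \<in> arr C"
  and src_idn [simp]: "X \<in> obj C \<Longrightarrow> src C (\<one> X) = X"
  and tgt_idn [simp]: "X \<in> obj C \<Longrightarrow> tgt C (\<one> X) = X"
  using idn_hom[of X] by (auto simp: hom_def)

lemma cmp_arr [simp]:
    "\<lbrakk>f \<in> arr C; g \<in> arr C; tgt C f = src C g\<rbrakk> \<Longrightarrow> g \<cdot> f \<in> arr C"
  and src_cmp [simp]:
    "\<lbrakk>f \<in> arr C; g \<in> arr C; tgt C f = src C g\<rbrakk> \<Longrightarrow> src C (g \<cdot> f) = src C f"
  and tgt_cmp [simp]:
    "\<lbrakk>f \<in> arr C; g \<in> arr C; tgt C f = src C g\<rbrakk> \<Longrightarrow> tgt C (g \<cdot> f) = tgt C g"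
  using cmp_hom[of f "src C f" "tgt C f" g "tgt C g"] by (auto simp: hom_def)

lemma cmp_idn_arr [simp]: "\<lbrakk>f \<in> arr C; src C f = X\<rbrakk> \<Longrightarrow> f \<cdot> \<one> X = f"
  using cmp_idn[of f X "tgt C f"] by (simp add: hom_def)

lemma idn_cmp_arr [simp]: "\<lbrakk>f \<in> arr C; tgt C f = Y\<rbrakk> \<Longrightarrow> \<one> Y \<cdot> f = f"
  using idn_cmp[of f "src C f" Y] by (simp add: hom_def)

lemma cmp_assoc_arr [simp]:
  "\<lbrakk>f \<in> arr C; g \<in> arr C; h \<in> arr C; tgt C f = src C g; tgt C g = src C h\<rbrakk>
    \<Longrightarrow> (h \<cdot> g) \<cdot> f = h \<cdot> (g \<cdot> f)"
  using cmp_assoc[of f "src C f" "src C g" g "src C h" h "tgt C h"] by (simp add: hom_def)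

lemmas src_tgt_obj [simp] = src_obj tgt_obj

text \<open>
  Composites are kept associated to the right, so an equation between composites can only be
  used for rewriting inside a longer one after it has been extended by an arbitrary tail.
\<close>

lemma cmp_eq_tail:
  "\<lbrakk>g \<cdot> f = k; f \<in> arr C; g \<in> arr C; tgt C f = src C g; z \<in> arr C; tgt C z = src C f\<rbrakk>
    \<Longrightarrow> g \<cdot> (f \<cdot> z) = k \<cdot> z"
  using cmp_assoc_arr[of z f g] by simp

lemma square_tail:
  "\<lbrakk>g \<cdot> f = k \<cdot> h; f \<in> arr C; g \<in> arr C; tgt C f = src C g;
    h \<in> arr C; k \<in> arr C; tgt C h = src C k; z \<in> arr C; tgt C z = src C f; src C h = src C f\<rbrakk>
    \<Longrightarrow> g \<cdot> (f \<cdot> z) = k \<cdot> (h \<cdot> z)"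
  using cmp_assoc_arr[of z f g] cmp_assoc_arr[of z h k] by simp

lemma inverse_arrows_unique:
  assumes "inverse_arrows C f g" and "inverse_arrows C f h"
  shows "g = h"
proof -
  have "g = g \<cdot> (f \<cdot> h)"
    using assms by (auto simp: inverse_arrows_def hom_def)
  also have "\<dots> = (g \<cdot> f) \<cdot> h"
    using assms by (subst cmp_assoc_arr) (auto simp: inverse_arrows_def hom_def)
  also have "\<dots> = h"
    using assms by (auto simp: inverse_arrows_def hom_def)
  finally show ?thesis .
qed

lemma iso_inverse_arrows:
  assumes "f \<in> iso C X Y"
  shows "inverse_arrows C f (inv_arr C f)"
  using assms inverse_arrows_unique theI[of "inverse_arrows C f"]
  unfolding iso_def inv_arr_def by blast

lemma iso_arr:
  assumes "f \<in> iso C X Y"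
  shows "f \<in> arr C" and "src C f = X" and "tgt C f = Y"
    and "inv_arr C f \<in> arr C" and "src C (inv_arr C f) = Y" and "tgt C (inv_arr C f) = X"
    and "inv_arr C f \<cdot> f = \<one> X" and "f \<cdot> inv_arr C f = \<one> Y"
  using iso_inverse_arrows[OF assms] assms
  by (auto simp: iso_def inverse_arrows_def hom_def)

lemma iso_cancel:
  assumes "f \<in> iso C X Y" and "z \<in> arr C"
  shows "tgt C z = X \<Longrightarrow> inv_arr C f \<cdot> (f \<cdot> z) = z"
    and "tgt C z = Y \<Longrightarrow> f \<cdot> (inv_arr C f \<cdot> z) = z"
  using assms(2) iso_arr[OF assms(1)] cmp_eq_tail[of "inv_arr C f" f _ z]
    cmp_eq_tail[of f "inv_arr C f" _ z] by auto

lemma iso_cancel_left: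
  assumes "f \<in> iso C X Y" and "f \<cdot> g = f \<cdot> h"
    and "g \<in> arr C" "h \<in> arr C" "tgt C g = X" "tgt C h = X"
  shows "g = h"
  using assms iso_cancel(1) by metis

lemma iso_cancel_right:
  assumes "f \<in> iso C X Y" and "g \<cdot> f = h \<cdot> f"
    and "g \<in> arr C" "h \<in> arr C" "src C g = Y" "src C h = Y"
  shows "g = h"
proof -
  have "g = (g \<cdot> f) \<cdot> inv_arr C f"
    using assms(3,5) iso_arr[OF assms(1)] by simp
  also have "\<dots> = h"
    unfolding assms(2) using assms(4,6) iso_arr[OF assms(1)] by simp
  finally show ?thesis .
qed

end

section \<open>Coherence of the unit constraints\<close>

context monoidal_category
begin

declare tensor_obj_obj [simp] unit_obj_obj [simp]

lemma tensor_arr [simp]: "\<lbrakk>f \<in> arr C; g \<in> arr C\<rbrakk> \<Longrightarrow> f \<otimes> g \<in> arr C"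
  and src_tensor [simp]: "\<lbrakk>f \<in> arr C; g \<in> arr C\<rbrakk> \<Longrightarrow> src C (f \<otimes> g) = src C f \<odot> src C g"
  and tgt_tensor [simp]: "\<lbrakk>f \<in> arr C; g \<in> arr C\<rbrakk> \<Longrightarrow> tgt C (f \<otimes> g) = tgt C f \<odot> tgt C g"
  using tensor_hom[of f "src C f" "tgt C f" g "src C g" "tgt C g"] by (auto simp: hom_def)

declare tensor_idn [simp]

lemma tensor_cmp_arr:
  "\<lbrakk>f \<in> arr C; g \<in> arr C; tgt C f = src C g; f' \<in> arr C; g' \<in> arr C; tgt C f' = src C g'\<rbrakk>
    \<Longrightarrow> (g \<otimes> g') \<cdot> (f \<otimes> f') = (g \<cdot> f) \<otimes> (g' \<cdot> f')"
  using tensor_cmp[of f "src C f" "src C g" g "tgt C g" f' "src C f'" "src C g'" g' "tgt C g'"]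
  by (simp add: hom_def)

lemmas tensor_cmp_ext = cmp_eq_tail[OF tensor_cmp_arr]

lemma whisker_left:
  "\<lbrakk>f \<in> arr C; g \<in> arr C; tgt C f = src C g; X \<in> obj C\<rbrakk>
    \<Longrightarrow> \<one> X \<otimes> (g \<cdot> f) = (\<one> X \<otimes> g) \<cdot> (\<one> X \<otimes> f)"
  using tensor_cmp_arr[of "\<one> X" "\<one> X" f g] by simp

lemma whisker_right:
  "\<lbrakk>f \<in> arr C; g \<in> arr C; tgt C f = src C g; X \<in> obj C\<rbrakk>
    \<Longrightarrow> (g \<cdot> f) \<otimes> \<one> X = (g \<otimes> \<one> X) \<cdot> (f \<otimes> \<one> X)"
  using tensor_cmp_arr[of f g "\<one> X" "\<one> X"] by simp

lemmas assoc_arr [simp] = iso_arr[OF assoc_iso]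
lemmas lunit_arr [simp] = iso_arr[OF lunit_iso]
lemmas runit_arr [simp] = iso_arr[OF runit_iso]
lemmas assoc_cancel [simp] = iso_cancel[OF assoc_iso]
lemmas lunit_cancel [simp] = iso_cancel[OF lunit_iso]
lemmas runit_cancel [simp] = iso_cancel[OF runit_iso]

lemma assoc_natural_arr:
  "\<lbrakk>f \<in> arr C; g \<in> arr C; h \<in> arr C; tgt C f = X'; tgt C g = Y'; tgt C h = Z'\<rbrakk>
    \<Longrightarrow> \<alpha> X' Y' Z' \<cdot> ((f \<otimes> g) \<otimes> h) = (f \<otimes> (g \<otimes> h)) \<cdot> \<alpha> (src C f) (src C g) (src C h)"
  using assoc_natural[of f "src C f" X' g "src C g" Y' h "src C h" Z'] by (simp add: hom_def)

lemma inv_assoc_natural_arr: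
  assumes [simp]: "f \<in> arr C" "g \<in> arr C" "h \<in> arr C"
  shows "inv_arr C (\<alpha> (tgt C f) (tgt C g) (tgt C h)) \<cdot> (f \<otimes> (g \<otimes> h))
    = ((f \<otimes> g) \<otimes> h) \<cdot> inv_arr C (\<alpha> (src C f) (src C g) (src C h))"
proof -
  let ?a = "\<alpha> (src C f) (src C g) (src C h)" and ?b = "\<alpha> (tgt C f) (tgt C g) (tgt C h)"
  have "inv_arr C ?b \<cdot> (f \<otimes> (g \<otimes> h))
      = inv_arr C ?b \<cdot> ((f \<otimes> (g \<otimes> h)) \<cdot> ?a) \<cdot> inv_arr C ?a"
    by simp
  also have "\<dots> = ((f \<otimes> g) \<otimes> h) \<cdot> inv_arr C ?a"
    by (subst assoc_natural_arr[symmetric]) auto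
  finally show ?thesis .
qed

lemma lunit_natural_arr:
  "f \<in> arr C \<Longrightarrow> \<l> (tgt C f) \<cdot> (\<one> \<I> \<otimes> f) = f \<cdot> \<l> (src C f)"
  using lunit_natural[of f "src C f" "tgt C f"] by (simp add: hom_def)

lemma runit_natural_arr:
  "f \<in> arr C \<Longrightarrow> \<r> (tgt C f) \<cdot> (f \<otimes> \<one> \<I>) = f \<cdot> \<r> (src C f)"
  using runit_natural[of f "src C f" "tgt C f"] by (simp add: hom_def)

lemma inv_lunit_natural_arr:
  assumes [simp]: "f \<in> arr C"
  shows "inv_arr C (\<l> (tgt C f)) \<cdot> f = (\<one> \<I> \<otimes> f) \<cdot> inv_arr C (\<l> (src C f))"
proof -
  have "inv_arr C (\<l> (tgt C f)) \<cdot> f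
      = inv_arr C (\<l> (tgt C f)) \<cdot> (f \<cdot> \<l> (src C f)) \<cdot> inv_arr C (\<l> (src C f))"
    by simp
  also have "\<dots> = (\<one> \<I> \<otimes> f) \<cdot> inv_arr C (\<l> (src C f))"
    by (subst lunit_natural_arr[symmetric]) auto
  finally show ?thesis .
qed

lemma inv_runit_natural_arr:
  assumes [simp]: "f \<in> arr C"
  shows "inv_arr C (\<r> (tgt C f)) \<cdot> f = (f \<otimes> \<one> \<I>) \<cdot> inv_arr C (\<r> (src C f))"
proof -
  have "inv_arr C (\<r> (tgt C f)) \<cdot> f
      = inv_arr C (\<r> (tgt C f)) \<cdot> (f \<cdot> \<r> (src C f)) \<cdot> inv_arr C (\<r> (src C f))"
    by simp
  also have "\<dots> = (f \<otimes> \<one> \<I>) \<cdot> inv_arr C (\<r> (src C f))"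
    by (subst runit_natural_arr[symmetric]) auto
  finally show ?thesis .
qed

lemma tensor_inverse:
  assumes "inverse_arrows C f g" and "inverse_arrows C f' g'"
  shows "inverse_arrows C (f \<otimes> f') (g \<otimes> g')"
  using assms by (auto simp: inverse_arrows_def hom_def tensor_cmp_arr)

lemma iso_tensor_idn:
  assumes "f \<in> iso C X Y" and "Z \<in> obj C"
  shows "f \<otimes> \<one> Z \<in> iso C (X \<odot> Z) (Y \<odot> Z)"
proof -
  have "inverse_arrows C (\<one> Z) (\<one> Z)"
    using assms(2) by (simp add: inverse_arrows_def hom_def)
  with iso_inverse_arrows[OF assms(1)] have "inverse_arrows C (f \<otimes> \<one> Z) (inv_arr C f \<otimes> \<one> Z)"
    by (rule tensor_inverse)
  then show ?thesis
    using iso_arr[OF assms(1)] assms(2) by (auto simp: iso_def hom_def)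
qed

lemma unit_tensor_faithful:
  assumes "\<one> \<I> \<otimes> f = \<one> \<I> \<otimes> g" and "f \<in> arr C" "g \<in> arr C"
    and "src C f = src C g" "tgt C f = tgt C g"
  shows "f = g"
proof (rule iso_cancel_right[OF lunit_iso[of "src C f"]])
  show "f \<cdot> \<l> (src C f) = g \<cdot> \<l> (src C f)"
    using lunit_natural_arr[of f] lunit_natural_arr[of g] assms by simp
qed (use assms in auto)

lemma tensor_unit_faithful:
  assumes "f \<otimes> \<one> \<I> = g \<otimes> \<one> \<I>" and "f \<in> arr C" "g \<in> arr C"
    and "src C f = src C g" "tgt C f = tgt C g"
  shows "f = g"
proof (rule iso_cancel_right[OF runit_iso[of "src C f"]])
  show "f \<cdot> \<r> (src C f) = g \<cdot> \<r> (src C f)"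
    using runit_natural_arr[of f] runit_natural_arr[of g] assms by simp
qed (use assms in auto)

text \<open>
  Tensoring with the unit is faithful, so the equation may be checked after applying \<open>\<one> \<I> \<otimes> _\<close>.
  There it is the pentagon for \<open>\<I>, \<I>, X, Y\<close> with both unit constraints on the inner \<open>\<I>\<close> traded
  by the triangle, up to the isomorphisms \<open>\<alpha> \<I> (\<I> \<odot> X) Y\<close> and \<open>\<alpha> \<I> \<I> X \<otimes> \<one> Y\<close>.
\<close>

lemma lunit_tensor:
  assumes [simp]: "X \<in> obj C" "Y \<in> obj C"
  shows "\<l> (X \<odot> Y) \<cdot> \<alpha> \<I> X Y = \<l> X \<otimes> \<one> Y"
proof (rule unit_tensor_faithful)
  have "(\<one> \<I> \<otimes> (\<l> (X \<odot> Y) \<cdot> \<alpha> \<I> X Y)) \<cdot> \<alpha> \<I> (\<I> \<odot> X) Y \<cdot> (\<alpha> \<I> \<I> X \<otimes> \<one> Y)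
      = (\<one> \<I> \<otimes> \<l> (X \<odot> Y)) \<cdot> (\<alpha> \<I> \<I> (X \<odot> Y) \<cdot> \<alpha> (\<I> \<odot> \<I>) X Y)"
    using pentagon[of \<I> \<I> X Y] by (simp add: whisker_left)
  also have "\<dots> = (\<r> \<I> \<otimes> \<one> (X \<odot> Y)) \<cdot> \<alpha> (\<I> \<odot> \<I>) X Y"
    by (subst cmp_eq_tail[OF triangle]) auto
  also have "\<dots> = \<alpha> \<I> X Y \<cdot> ((\<r> \<I> \<otimes> \<one> X) \<otimes> \<one> Y)"
    using assoc_natural_arr[of "\<r> \<I>" "\<one> X" "\<one> Y"] by simp
  also have "\<dots> = \<alpha> \<I> X Y \<cdot> (((\<one> \<I> \<otimes> \<l> X) \<otimes> \<one> Y) \<cdot> (\<alpha> \<I> \<I> X \<otimes> \<one> Y))"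
    using triangle[of \<I> X] by (simp flip: whisker_right)
  also have "\<dots> = (\<one> \<I> \<otimes> (\<l> X \<otimes> \<one> Y)) \<cdot> \<alpha> \<I> (\<I> \<odot> X) Y \<cdot> (\<alpha> \<I> \<I> X \<otimes> \<one> Y)"
    using assoc_natural_arr[of "\<one> \<I>" "\<l> X" "\<one> Y"] by (subst square_tail) auto
  finally have *: "(\<one> \<I> \<otimes> (\<l> (X \<odot> Y) \<cdot> \<alpha> \<I> X Y)) \<cdot> \<alpha> \<I> (\<I> \<odot> X) Y \<cdot> (\<alpha> \<I> \<I> X \<otimes> \<one> Y)
      = (\<one> \<I> \<otimes> (\<l> X \<otimes> \<one> Y)) \<cdot> \<alpha> \<I> (\<I> \<odot> X) Y \<cdot> (\<alpha> \<I> \<I> X \<otimes> \<one> Y)" .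
  have **: "(\<one> \<I> \<otimes> (\<l> (X \<odot> Y) \<cdot> \<alpha> \<I> X Y)) \<cdot> \<alpha> \<I> (\<I> \<odot> X) Y
      = (\<one> \<I> \<otimes> (\<l> X \<otimes> \<one> Y)) \<cdot> \<alpha> \<I> (\<I> \<odot> X) Y"
    by (rule iso_cancel_right[OF iso_tensor_idn[OF assoc_iso[of \<I> \<I> X], of Y]])
      (use * in auto)
  show "\<one> \<I> \<otimes> (\<l> (X \<odot> Y) \<cdot> \<alpha> \<I> X Y) = \<one> \<I> \<otimes> (\<l> X \<otimes> \<one> Y)"
    by (rule iso_cancel_right[OF assoc_iso[of \<I> "\<I> \<odot> X" Y] ]) (use ** in auto)
qed auto

text \<open>
  Naturality of \<open>\<l>\<close> at \<open>\<l> \<I>\<close> gives \<open>\<l> (\<I> \<odot> \<I>) = \<one> \<I> \<otimes> \<l> \<I>\<close>; hence \<open>lunit_tensor\<close> and the triangle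
  express \<open>\<l> \<I> \<otimes> \<one> \<I>\<close> and \<open>\<r> \<I> \<otimes> \<one> \<I>\<close> by the same composite.
\<close>

lemma lunit_unit_eq_runit_unit: "\<l> \<I> = \<r> \<I>"
proof (rule tensor_unit_faithful)
  have "\<l> (\<I> \<odot> \<I>) = \<one> \<I> \<otimes> \<l> \<I>"
    by (rule iso_cancel_left[OF lunit_iso[of \<I>]]) (use lunit_natural_arr[of "\<l> \<I>"] in auto)
  then show "\<l> \<I> \<otimes> \<one> \<I> = \<r> \<I> \<otimes> \<one> \<I>"
    using lunit_tensor[of \<I> \<I>] triangle[of \<I> \<I>] by simp
qed auto

section \<open>Duals in a monoidal category\<close>

text \<open>
  The unit and the counit, at \<open>Y\<close>, of the adjunction between \<open>L \<odot> _\<close> and \<open>X \<odot> _\<close> that a dual pair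
  induces, for an arrow \<open>d : \<I> \<rightarrow> X \<odot> L\<close> here and \<open>e : L \<odot> X \<rightarrow> \<I>\<close> below.
\<close>

definition coev_tensor :: "'o \<Rightarrow> 'o \<Rightarrow> 'm \<Rightarrow> 'o \<Rightarrow> 'm" where
  "coev_tensor X L d Y = \<alpha> X L Y \<cdot> (d \<otimes> \<one> Y) \<cdot> inv_arr C (\<l> Y)"

definition ev_tensor :: "'o \<Rightarrow> 'o \<Rightarrow> 'm \<Rightarrow> 'o \<Rightarrow> 'm" where
  "ev_tensor L X e Y = \<l> Y \<cdot> (e \<otimes> \<one> Y) \<cdot> inv_arr C (\<alpha> L X Y)"

lemma coev_tensor_arr:
  assumes "d \<in> arr C" "src C d = \<I>" "tgt C d = X \<odot> L" "X \<in> obj C" "L \<in> obj C" "Y \<in> obj C"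
  shows "coev_tensor X L d Y \<in> arr C" and "src C (coev_tensor X L d Y) = Y"
    and "tgt C (coev_tensor X L d Y) = X \<odot> (L \<odot> Y)"
  using assms by (simp_all add: coev_tensor_def)

lemma ev_tensor_arr:
  assumes "e \<in> arr C" "src C e = L \<odot> X" "tgt C e = \<I>" "L \<in> obj C" "X \<in> obj C" "Y \<in> obj C"
  shows "ev_tensor L X e Y \<in> arr C" and "src C (ev_tensor L X e Y) = L \<odot> (X \<odot> Y)"
    and "tgt C (ev_tensor L X e Y) = Y"
  using assms by (simp_all add: ev_tensor_def)

lemma coev_tensor_natural:
  assumes d: "d \<in> arr C" "src C d = \<I>" "tgt C d = X \<odot> L" and XL: "X \<in> obj C" "L \<in> obj C"
    and f: "f \<in> arr C"
  shows "coev_tensor X L d (tgt C f) \<cdot> f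
    = (\<one> X \<otimes> (\<one> L \<otimes> f)) \<cdot> coev_tensor X L d (src C f)"
proof -
  note [simp] = assms
  have "coev_tensor X L d (tgt C f) \<cdot> f
      = \<alpha> X L (tgt C f) \<cdot> (d \<otimes> f) \<cdot> inv_arr C (\<l> (src C f))"
    by (simp add: coev_tensor_def inv_lunit_natural_arr tensor_cmp_ext)
  also have "\<dots> = \<alpha> X L (tgt C f) \<cdot> ((\<one> X \<otimes> \<one> L) \<otimes> f) \<cdot> (d \<otimes> \<one> (src C f))
      \<cdot> inv_arr C (\<l> (src C f))"
    by (simp add: tensor_cmp_ext)
  also have "\<dots> = (\<one> X \<otimes> (\<one> L \<otimes> f)) \<cdot> coev_tensor X L d (src C f)"
    unfolding coev_tensor_def by (subst square_tail[OF assoc_natural_arr]) auto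
  finally show ?thesis .
qed

text \<open>
  This is the first triangle identity of the dual, tensored with \<open>Y\<close>; only the bracketing differs.
  The pentagon moves the brackets, and \<open>lunit_tensor\<close> splits the unit constraint at \<open>X \<odot> Y\<close>.
\<close>

lemma zigzag:
  assumes dual: "left_dual C X L d e" and Y: "Y \<in> obj C"
  shows "(\<one> X \<otimes> ev_tensor L X e Y) \<cdot> coev_tensor X L d (X \<odot> Y) = \<one> (X \<odot> Y)"
proof -
  have [simp]: "X \<in> obj C" "L \<in> obj C" "Y \<in> obj C"
      "d \<in> arr C" "src C d = \<I>" "tgt C d = X \<odot> L"
      "e \<in> arr C" "src C e = L \<odot> X" "tgt C e = \<I>"
    using dual Y by (auto simp: left_dual_def hom_def)
  have tri: "\<r> X \<cdot> (\<one> X \<otimes> e) \<cdot> \<alpha> X L X \<cdot> (d \<otimes> \<one> X) \<cdot> inv_arr C (\<l> X) = \<one> X"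
    using dual by (simp add: left_dual_def)
  have unit: "inv_arr C (\<l> (X \<odot> Y)) = \<alpha> \<I> X Y \<cdot> (inv_arr C (\<l> X) \<otimes> \<one> Y)"
  proof (rule iso_cancel_left[OF lunit_iso[of "X \<odot> Y"]])
    show "\<l> (X \<odot> Y) \<cdot> inv_arr C (\<l> (X \<odot> Y))
        = \<l> (X \<odot> Y) \<cdot> \<alpha> \<I> X Y \<cdot> (inv_arr C (\<l> X) \<otimes> \<one> Y)"
      by (subst cmp_eq_tail[OF lunit_tensor]) (auto simp: tensor_cmp_arr)
  qed auto
  let ?t = "(d \<otimes> \<one> X) \<cdot> inv_arr C (\<l> X)"
  have "coev_tensor X L d (X \<odot> Y)
      = \<alpha> X L (X \<odot> Y) \<cdot> \<alpha> (X \<odot> L) X Y \<cdot> (?t \<otimes> \<one> Y)"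
    using square_tail[OF assoc_natural_arr[of d "\<one> X" "\<one> Y", OF _ _ _ refl refl refl]]
    by (simp add: coev_tensor_def unit whisker_right)
  also have "\<dots> = (\<one> X \<otimes> \<alpha> L X Y) \<cdot> \<alpha> X (L \<odot> X) Y \<cdot> ((\<alpha> X L X \<cdot> ?t) \<otimes> \<one> Y)"
    using square_tail[OF pentagon[symmetric, of X L X Y], of "?t \<otimes> \<one> Y"]
    by (simp add: whisker_right)
  finally have coev: "coev_tensor X L d (X \<odot> Y)
      = (\<one> X \<otimes> \<alpha> L X Y) \<cdot> \<alpha> X (L \<odot> X) Y \<cdot> ((\<alpha> X L X \<cdot> ?t) \<otimes> \<one> Y)" .
  have cancel: "(\<one> X \<otimes> inv_arr C (\<alpha> L X Y)) \<cdot> (\<one> X \<otimes> \<alpha> L X Y) = \<one> (X \<odot> ((L \<odot> X) \<odot> Y))"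
    by (simp add: tensor_cmp_arr)
  have "(\<one> X \<otimes> ev_tensor L X e Y) \<cdot> coev_tensor X L d (X \<odot> Y)
      = (\<one> X \<otimes> \<l> Y) \<cdot> (\<one> X \<otimes> (e \<otimes> \<one> Y)) \<cdot> \<alpha> X (L \<odot> X) Y \<cdot> ((\<alpha> X L X \<cdot> ?t) \<otimes> \<one> Y)"
    using cmp_eq_tail[OF cancel] by (simp add: coev ev_tensor_def whisker_left)
  also have "\<dots> = (\<one> X \<otimes> \<l> Y) \<cdot> \<alpha> X \<I> Y \<cdot> (((\<one> X \<otimes> e) \<cdot> \<alpha> X L X \<cdot> ?t) \<otimes> \<one> Y)"
    using square_tail[OF assoc_natural_arr[of "\<one> X" e "\<one> Y", OF _ _ _ refl refl refl],
        of "(\<alpha> X L X \<cdot> ?t) \<otimes> \<one> Y"]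
    by (simp add: whisker_right)
  also have "\<dots> = (\<r> X \<cdot> (\<one> X \<otimes> e) \<cdot> \<alpha> X L X \<cdot> ?t) \<otimes> \<one> Y"
    by (subst cmp_eq_tail[OF triangle]) (auto simp: whisker_right)
  also have "\<dots> = \<one> (X \<odot> Y)"
    by (simp add: tri)
  finally show ?thesis .
qed

text \<open>
  In a strict category the triangle identity for a dual of \<open>\<I>\<close> reads \<open>e \<cdot> d = 1\<close>. Reading the
  factors \<open>\<one> \<I> \<otimes> _\<close> and \<open>_ \<otimes> \<one> \<I>\<close> in it by naturality of \<open>\<l>\<close> and \<open>\<r>\<close> gives the general form.
\<close>

lemma unit_dual_retract:
  assumes dual: "left_dual C \<I> L d e"
  shows "e \<cdot> inv_arr C (\<r> L) \<cdot> \<l> L \<cdot> d = \<one> \<I>"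
proof -
  have [simp]: "L \<in> obj C" "d \<in> arr C" "src C d = \<I>" "tgt C d = \<I> \<odot> L"
      "e \<in> arr C" "src C e = L \<odot> \<I>" "tgt C e = \<I>"
    using dual by (auto simp: left_dual_def hom_def)
  have "\<one> \<I> = \<l> \<I> \<cdot> (\<one> \<I> \<otimes> e) \<cdot> \<alpha> \<I> L \<I> \<cdot> (d \<otimes> \<one> \<I>) \<cdot> inv_arr C (\<r> \<I>)"
    using dual by (simp add: left_dual_def lunit_unit_eq_runit_unit)
  also have "\<dots> = e \<cdot> \<l> (L \<odot> \<I>) \<cdot> \<alpha> \<I> L \<I> \<cdot> (d \<otimes> \<one> \<I>) \<cdot> inv_arr C (\<r> \<I>)"
    using square_tail[OF lunit_natural_arr[of e]] by simp
  also have "\<dots> = e \<cdot> ((\<l> L \<cdot> d) \<otimes> \<one> \<I>) \<cdot> inv_arr C (\<r> \<I>)"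
    using cmp_eq_tail[OF lunit_tensor[of L \<I>]] by (simp add: whisker_right)
  also have "\<dots> = e \<cdot> inv_arr C (\<r> L) \<cdot> \<l> L \<cdot> d"
    using inv_runit_natural_arr[of "\<l> L \<cdot> d"] by simp
  finally show ?thesis
    by (rule sym)
qed

end

section \<open>Monoidal functors preserving a dual\<close>

context monoidal_functor
begin

lemma amap_arr [simp]: "f \<in> arr C \<Longrightarrow> amap F f \<in> arr D"
  and src_amap [simp]: "f \<in> arr C \<Longrightarrow> src D (amap F f) = omap F (src C f)"
  and tgt_amap [simp]: "f \<in> arr C \<Longrightarrow> tgt D (amap F f) = omap F (tgt C f)"
  using amap_hom[of f "src C f" "tgt C f"] by (auto simp: hom_def)

declare omap_obj [simp] amap_idn [simp]

lemma amap_cmp_arr: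
  "\<lbrakk>f \<in> arr C; g \<in> arr C; tgt C f = src C g\<rbrakk>
    \<Longrightarrow> amap F (g \<cdot>\<^bsub>C\<^esub> f) = amap F g \<cdot>\<^bsub>D\<^esub> amap F f"
  using amap_cmp[of f "src C f" "src C g" g "tgt C g"] by (simp add: hom_def)

lemma f2_arr [simp]:
  assumes "X \<in> obj C" "Y \<in> obj C"
  shows "f2 X Y \<in> arr D" and "src D (f2 X Y) = omap F X \<odot>\<^bsub>D\<^esub> omap F Y"
    and "tgt D (f2 X Y) = omap F (X \<odot>\<^bsub>C\<^esub> Y)"
  using f2_hom[OF assms] by (auto simp: hom_def)

lemma f0_arr [simp]: "f0 \<in> arr D" "src D f0 = \<I>\<^bsub>D\<^esub>" "tgt D f0 = omap F \<I>\<^bsub>C\<^esub>"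
  using f0_hom by (auto simp: hom_def)

lemma f2_natural_arr:
  "\<lbrakk>f \<in> arr C; g \<in> arr C\<rbrakk>
    \<Longrightarrow> f2 (tgt C f) (tgt C g) \<cdot>\<^bsub>D\<^esub> (amap F f \<otimes>\<^bsub>D\<^esub> amap F g)
      = amap F (f \<otimes>\<^bsub>C\<^esub> g) \<cdot>\<^bsub>D\<^esub> f2 (src C f) (src C g)"
  using f2_natural[of f "src C f" "tgt C f" g "src C g" "tgt C g"] by (simp add: hom_def)

lemma amap_iso:
  assumes "f \<in> iso C X Y"
  shows "amap F (inv_arr C f) \<cdot>\<^bsub>D\<^esub> amap F f = \<one>\<^bsub>D\<^esub> (omap F X)"
    and "amap F f \<cdot>\<^bsub>D\<^esub> amap F (inv_arr C f) = \<one>\<^bsub>D\<^esub> (omap F Y)"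
proof -
  note [simp] = C.iso_arr[OF assms]
  have "X \<in> obj C" "Y \<in> obj C"
    using C.src_obj[of f] C.tgt_obj[of f] by simp_all
  then show "amap F (inv_arr C f) \<cdot>\<^bsub>D\<^esub> amap F f = \<one>\<^bsub>D\<^esub> (omap F X)"
    and "amap F f \<cdot>\<^bsub>D\<^esub> amap F (inv_arr C f) = \<one>\<^bsub>D\<^esub> (omap F Y)"
    by (simp_all flip: amap_cmp_arr)
qed

lemma f2_inv_assoc:
  assumes [simp]: "X \<in> obj C" "Y \<in> obj C" "Z \<in> obj C"
  shows "amap F (inv_arr C (\<alpha>\<^bsub>C\<^esub> X Y Z)) \<cdot>\<^bsub>D\<^esub> f2 X (Y \<odot>\<^bsub>C\<^esub> Z)
      \<cdot>\<^bsub>D\<^esub> (\<one>\<^bsub>D\<^esub> (omap F X) \<otimes>\<^bsub>D\<^esub> f2 Y Z)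
    = f2 (X \<odot>\<^bsub>C\<^esub> Y) Z \<cdot>\<^bsub>D\<^esub> (f2 X Y \<otimes>\<^bsub>D\<^esub> \<one>\<^bsub>D\<^esub> (omap F Z))
      \<cdot>\<^bsub>D\<^esub> inv_arr D (\<alpha>\<^bsub>D\<^esub> (omap F X) (omap F Y) (omap F Z))"
    (is "?Fa' \<cdot>\<^bsub>D\<^esub> ?r = _ \<cdot>\<^bsub>D\<^esub> _ \<cdot>\<^bsub>D\<^esub> inv_arr D ?a")
proof -
  have "?Fa' \<cdot>\<^bsub>D\<^esub> ?r = ?Fa' \<cdot>\<^bsub>D\<^esub> (?r \<cdot>\<^bsub>D\<^esub> ?a) \<cdot>\<^bsub>D\<^esub> inv_arr D ?a"
    by simp
  also have "?r \<cdot>\<^bsub>D\<^esub> ?a = amap F (\<alpha>\<^bsub>C\<^esub> X Y Z) \<cdot>\<^bsub>D\<^esub> f2 (X \<odot>\<^bsub>C\<^esub> Y) Z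
      \<cdot>\<^bsub>D\<^esub> (f2 X Y \<otimes>\<^bsub>D\<^esub> \<one>\<^bsub>D\<^esub> (omap F Z))"
    using f2_assoc[of X Y Z] by simp
  finally show ?thesis
    by (simp add: D.cmp_eq_tail[OF amap_iso(1)[OF C.assoc_iso]])
qed

lemma f2_unit_left:
  assumes [simp]: "Z \<in> obj C"
  shows "f2 \<I>\<^bsub>C\<^esub> Z \<cdot>\<^bsub>D\<^esub> (f0 \<otimes>\<^bsub>D\<^esub> \<one>\<^bsub>D\<^esub> (omap F Z)) \<cdot>\<^bsub>D\<^esub> inv_arr D (\<l>\<^bsub>D\<^esub> (omap F Z))
    = amap F (inv_arr C (\<l>\<^bsub>C\<^esub> Z))"
proof -
  let ?t = "f2 \<I>\<^bsub>C\<^esub> Z \<cdot>\<^bsub>D\<^esub> (f0 \<otimes>\<^bsub>D\<^esub> \<one>\<^bsub>D\<^esub> (omap F Z))"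
  have "?t \<cdot>\<^bsub>D\<^esub> inv_arr D (\<l>\<^bsub>D\<^esub> (omap F Z))
      = amap F (inv_arr C (\<l>\<^bsub>C\<^esub> Z)) \<cdot>\<^bsub>D\<^esub> (amap F (\<l>\<^bsub>C\<^esub> Z) \<cdot>\<^bsub>D\<^esub> ?t) \<cdot>\<^bsub>D\<^esub> inv_arr D (\<l>\<^bsub>D\<^esub> (omap F Z))"
    by (simp add: D.cmp_eq_tail[OF amap_iso(1)[OF C.lunit_iso]])
  also have "\<dots> = amap F (inv_arr C (\<l>\<^bsub>C\<^esub> Z))"
    by (simp only: f0_lunit[OF assms]) simp
  finally show "f2 \<I>\<^bsub>C\<^esub> Z \<cdot>\<^bsub>D\<^esub> (f0 \<otimes>\<^bsub>D\<^esub> \<one>\<^bsub>D\<^esub> (omap F Z)) \<cdot>\<^bsub>D\<^esub> inv_arr D (\<l>\<^bsub>D\<^esub> (omap F Z))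
    = amap F (inv_arr C (\<l>\<^bsub>C\<^esub> Z))"
    by simp
qed

lemma f2_unit_right:
  assumes [simp]: "Z \<in> obj C"
  shows "f2 Z \<I>\<^bsub>C\<^esub> \<cdot>\<^bsub>D\<^esub> (\<one>\<^bsub>D\<^esub> (omap F Z) \<otimes>\<^bsub>D\<^esub> f0) \<cdot>\<^bsub>D\<^esub> inv_arr D (\<r>\<^bsub>D\<^esub> (omap F Z))
    = amap F (inv_arr C (\<r>\<^bsub>C\<^esub> Z))"
proof -
  let ?t = "f2 Z \<I>\<^bsub>C\<^esub> \<cdot>\<^bsub>D\<^esub> (\<one>\<^bsub>D\<^esub> (omap F Z) \<otimes>\<^bsub>D\<^esub> f0)"
  have "?t \<cdot>\<^bsub>D\<^esub> inv_arr D (\<r>\<^bsub>D\<^esub> (omap F Z))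
      = amap F (inv_arr C (\<r>\<^bsub>C\<^esub> Z)) \<cdot>\<^bsub>D\<^esub> (amap F (\<r>\<^bsub>C\<^esub> Z) \<cdot>\<^bsub>D\<^esub> ?t) \<cdot>\<^bsub>D\<^esub> inv_arr D (\<r>\<^bsub>D\<^esub> (omap F Z))"
    by (simp add: D.cmp_eq_tail[OF amap_iso(1)[OF C.runit_iso]])
  also have "\<dots> = amap F (inv_arr C (\<r>\<^bsub>C\<^esub> Z))"
    by (simp only: f0_runit[OF assms]) simp
  finally show ?thesis
    by simp
qed

text \<open>
  The objects \<open>L\<close> and \<open>M\<close> stand for duals of \<open>X\<close> and \<open>FX\<close>, and \<open>k : M \<rightarrow> FL\<close> compares them. Associativity of \<open>f2\<close> brings the factors \<open>FX\<close> and \<open>FL\<close> together, so that the hypothesis on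
  \<open>d\<close> and \<open>d'\<close> applies; the \<open>f0\<close> that it produces is absorbed by the left unit law.
\<close>

lemma f2_coev_tensor:
  assumes [simp]: "X \<in> obj C" "L \<in> obj C" "Z \<in> obj C"
    and d [simp]: "d \<in> arr C" "src C d = \<I>\<^bsub>C\<^esub>" "tgt C d = X \<odot>\<^bsub>C\<^esub> L"
    and M [simp]: "M \<in> obj D"
    and d' [simp]: "d' \<in> arr D" "src D d' = \<I>\<^bsub>D\<^esub>" "tgt D d' = omap F X \<odot>\<^bsub>D\<^esub> M"
    and k [simp]: "k \<in> arr D" "src D k = M" "tgt D k = omap F L"
    and kd: "f2 X L \<cdot>\<^bsub>D\<^esub> (\<one>\<^bsub>D\<^esub> (omap F X) \<otimes>\<^bsub>D\<^esub> k) \<cdot>\<^bsub>D\<^esub> d' = amap F d \<cdot>\<^bsub>D\<^esub> f0"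
  shows "f2 X (L \<odot>\<^bsub>C\<^esub> Z) \<cdot>\<^bsub>D\<^esub> (\<one>\<^bsub>D\<^esub> (omap F X) \<otimes>\<^bsub>D\<^esub> (f2 L Z \<cdot>\<^bsub>D\<^esub> (k \<otimes>\<^bsub>D\<^esub> \<one>\<^bsub>D\<^esub> (omap F Z))))
      \<cdot>\<^bsub>D\<^esub> D.coev_tensor (omap F X) M d' (omap F Z)
    = amap F (C.coev_tensor X L d Z)"
proof -
  let ?X = "\<one>\<^bsub>D\<^esub> (omap F X)" and ?Z = "\<one>\<^bsub>D\<^esub> (omap F Z)"
    and ?l = "inv_arr D (\<l>\<^bsub>D\<^esub> (omap F Z))"
  have "f2 X (L \<odot>\<^bsub>C\<^esub> Z) \<cdot>\<^bsub>D\<^esub> (?X \<otimes>\<^bsub>D\<^esub> (f2 L Z \<cdot>\<^bsub>D\<^esub> (k \<otimes>\<^bsub>D\<^esub> ?Z)))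
        \<cdot>\<^bsub>D\<^esub> D.coev_tensor (omap F X) M d' (omap F Z)
      = f2 X (L \<odot>\<^bsub>C\<^esub> Z) \<cdot>\<^bsub>D\<^esub> (?X \<otimes>\<^bsub>D\<^esub> f2 L Z) \<cdot>\<^bsub>D\<^esub> \<alpha>\<^bsub>D\<^esub> (omap F X) (omap F L) (omap F Z)
        \<cdot>\<^bsub>D\<^esub> ((?X \<otimes>\<^bsub>D\<^esub> k) \<otimes>\<^bsub>D\<^esub> ?Z) \<cdot>\<^bsub>D\<^esub> (d' \<otimes>\<^bsub>D\<^esub> ?Z) \<cdot>\<^bsub>D\<^esub> ?l"
    using D.square_tail[OF D.assoc_natural_arr[of ?X k ?Z, OF _ _ _ refl refl refl],
        of "(d' \<otimes>\<^bsub>D\<^esub> ?Z) \<cdot>\<^bsub>D\<^esub> ?l"]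
    by (simp add: D.coev_tensor_def D.whisker_left)
  also have "\<dots> = (f2 X (L \<odot>\<^bsub>C\<^esub> Z) \<cdot>\<^bsub>D\<^esub> (?X \<otimes>\<^bsub>D\<^esub> f2 L Z) \<cdot>\<^bsub>D\<^esub> \<alpha>\<^bsub>D\<^esub> (omap F X) (omap F L) (omap F Z))
        \<cdot>\<^bsub>D\<^esub> (((?X \<otimes>\<^bsub>D\<^esub> k) \<cdot>\<^bsub>D\<^esub> d') \<otimes>\<^bsub>D\<^esub> ?Z) \<cdot>\<^bsub>D\<^esub> ?l"
    by (simp add: D.whisker_right)
  also have "\<dots> = amap F (\<alpha>\<^bsub>C\<^esub> X L Z) \<cdot>\<^bsub>D\<^esub> f2 (X \<odot>\<^bsub>C\<^esub> L) Z
        \<cdot>\<^bsub>D\<^esub> ((f2 X L \<cdot>\<^bsub>D\<^esub> (?X \<otimes>\<^bsub>D\<^esub> k) \<cdot>\<^bsub>D\<^esub> d') \<otimes>\<^bsub>D\<^esub> ?Z) \<cdot>\<^bsub>D\<^esub> ?l"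
    unfolding f2_assoc[of X L Z, symmetric, simplified] by (simp add: D.whisker_right)
  also have "\<dots> = amap F (\<alpha>\<^bsub>C\<^esub> X L Z) \<cdot>\<^bsub>D\<^esub> (f2 (X \<odot>\<^bsub>C\<^esub> L) Z \<cdot>\<^bsub>D\<^esub> (amap F d \<otimes>\<^bsub>D\<^esub> ?Z))
        \<cdot>\<^bsub>D\<^esub> (f0 \<otimes>\<^bsub>D\<^esub> ?Z) \<cdot>\<^bsub>D\<^esub> ?l"
    unfolding kd by (simp add: D.whisker_right)
  also have "f2 (X \<odot>\<^bsub>C\<^esub> L) Z \<cdot>\<^bsub>D\<^esub> (amap F d \<otimes>\<^bsub>D\<^esub> ?Z)
      = amap F (d \<otimes>\<^bsub>C\<^esub> \<one>\<^bsub>C\<^esub> Z) \<cdot>\<^bsub>D\<^esub> f2 \<I>\<^bsub>C\<^esub> Z"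
    using f2_natural_arr[of d "\<one>\<^bsub>C\<^esub> Z"] by simp
  also have "amap F (\<alpha>\<^bsub>C\<^esub> X L Z) \<cdot>\<^bsub>D\<^esub> (amap F (d \<otimes>\<^bsub>C\<^esub> \<one>\<^bsub>C\<^esub> Z) \<cdot>\<^bsub>D\<^esub> f2 \<I>\<^bsub>C\<^esub> Z)
        \<cdot>\<^bsub>D\<^esub> (f0 \<otimes>\<^bsub>D\<^esub> ?Z) \<cdot>\<^bsub>D\<^esub> ?l
      = amap F (C.coev_tensor X L d Z)"
    by (simp add: f2_unit_left C.coev_tensor_def amap_cmp_arr)
  finally show ?thesis .
qed

text \<open>
  The counterpart for evaluation: associativity of \<open>f2\<close>, used backwards, brings \<open>FL\<close> and \<open>FX\<close>
  together, and the \<open>f0\<close> produced by the hypothesis on \<open>e\<close> and \<open>e'\<close> meets the left unit law.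
\<close>

lemma f2_ev_tensor:
  assumes [simp]: "X \<in> obj C" "L \<in> obj C" "Y \<in> obj C"
    and e [simp]: "e \<in> arr C" "src C e = L \<odot>\<^bsub>C\<^esub> X" "tgt C e = \<I>\<^bsub>C\<^esub>"
    and M [simp]: "M \<in> obj D"
    and e' [simp]: "e' \<in> arr D" "src D e' = M \<odot>\<^bsub>D\<^esub> omap F X" "tgt D e' = \<I>\<^bsub>D\<^esub>"
    and k [simp]: "k \<in> arr D" "src D k = M" "tgt D k = omap F L"
    and ke: "amap F e \<cdot>\<^bsub>D\<^esub> f2 L X \<cdot>\<^bsub>D\<^esub> (k \<otimes>\<^bsub>D\<^esub> \<one>\<^bsub>D\<^esub> (omap F X)) = f0 \<cdot>\<^bsub>D\<^esub> e'"
  shows "amap F (C.ev_tensor L X e Y) \<cdot>\<^bsub>D\<^esub> f2 L (X \<odot>\<^bsub>C\<^esub> Y) \<cdot>\<^bsub>D\<^esub> (k \<otimes>\<^bsub>D\<^esub> f2 X Y)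
    = D.ev_tensor M (omap F X) e' (omap F Y)"
proof -
  let ?X = "\<one>\<^bsub>D\<^esub> (omap F X)" and ?Y = "\<one>\<^bsub>D\<^esub> (omap F Y)" and ?L = "\<one>\<^bsub>D\<^esub> (omap F L)"
    and ?a = "inv_arr D (\<alpha>\<^bsub>D\<^esub> M (omap F X) (omap F Y))"
  have "amap F (inv_arr C (\<alpha>\<^bsub>C\<^esub> L X Y)) \<cdot>\<^bsub>D\<^esub> f2 L (X \<odot>\<^bsub>C\<^esub> Y) \<cdot>\<^bsub>D\<^esub> (k \<otimes>\<^bsub>D\<^esub> f2 X Y)
      = (amap F (inv_arr C (\<alpha>\<^bsub>C\<^esub> L X Y)) \<cdot>\<^bsub>D\<^esub> f2 L (X \<odot>\<^bsub>C\<^esub> Y) \<cdot>\<^bsub>D\<^esub> (?L \<otimes>\<^bsub>D\<^esub> f2 X Y))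
        \<cdot>\<^bsub>D\<^esub> (k \<otimes>\<^bsub>D\<^esub> (?X \<otimes>\<^bsub>D\<^esub> ?Y))"
    by (simp add: D.tensor_cmp_arr)
  also have "\<dots> = f2 (L \<odot>\<^bsub>C\<^esub> X) Y \<cdot>\<^bsub>D\<^esub> (f2 L X \<otimes>\<^bsub>D\<^esub> ?Y) \<cdot>\<^bsub>D\<^esub> ((k \<otimes>\<^bsub>D\<^esub> ?X) \<otimes>\<^bsub>D\<^esub> ?Y) \<cdot>\<^bsub>D\<^esub> ?a"
    unfolding f2_inv_assoc[of L X Y, simplified]
    using D.inv_assoc_natural_arr[of k ?X ?Y] by simp
  also have "\<dots> = f2 (L \<odot>\<^bsub>C\<^esub> X) Y \<cdot>\<^bsub>D\<^esub> ((f2 L X \<cdot>\<^bsub>D\<^esub> (k \<otimes>\<^bsub>D\<^esub> ?X)) \<otimes>\<^bsub>D\<^esub> ?Y) \<cdot>\<^bsub>D\<^esub> ?a"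
    by (simp add: D.whisker_right)
  finally have "amap F (C.ev_tensor L X e Y) \<cdot>\<^bsub>D\<^esub> f2 L (X \<odot>\<^bsub>C\<^esub> Y) \<cdot>\<^bsub>D\<^esub> (k \<otimes>\<^bsub>D\<^esub> f2 X Y)
      = amap F (\<l>\<^bsub>C\<^esub> Y) \<cdot>\<^bsub>D\<^esub> (amap F (e \<otimes>\<^bsub>C\<^esub> \<one>\<^bsub>C\<^esub> Y) \<cdot>\<^bsub>D\<^esub> f2 (L \<odot>\<^bsub>C\<^esub> X) Y)
        \<cdot>\<^bsub>D\<^esub> ((f2 L X \<cdot>\<^bsub>D\<^esub> (k \<otimes>\<^bsub>D\<^esub> ?X)) \<otimes>\<^bsub>D\<^esub> ?Y) \<cdot>\<^bsub>D\<^esub> ?a"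
    by (simp add: C.ev_tensor_def amap_cmp_arr)
  also have "amap F (e \<otimes>\<^bsub>C\<^esub> \<one>\<^bsub>C\<^esub> Y) \<cdot>\<^bsub>D\<^esub> f2 (L \<odot>\<^bsub>C\<^esub> X) Y
      = f2 \<I>\<^bsub>C\<^esub> Y \<cdot>\<^bsub>D\<^esub> (amap F e \<otimes>\<^bsub>D\<^esub> ?Y)"
    using f2_natural_arr[of e "\<one>\<^bsub>C\<^esub> Y"] by simp
  also have "amap F (\<l>\<^bsub>C\<^esub> Y) \<cdot>\<^bsub>D\<^esub> (f2 \<I>\<^bsub>C\<^esub> Y \<cdot>\<^bsub>D\<^esub> (amap F e \<otimes>\<^bsub>D\<^esub> ?Y))
        \<cdot>\<^bsub>D\<^esub> ((f2 L X \<cdot>\<^bsub>D\<^esub> (k \<otimes>\<^bsub>D\<^esub> ?X)) \<otimes>\<^bsub>D\<^esub> ?Y) \<cdot>\<^bsub>D\<^esub> ?a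
      = amap F (\<l>\<^bsub>C\<^esub> Y) \<cdot>\<^bsub>D\<^esub> f2 \<I>\<^bsub>C\<^esub> Y
        \<cdot>\<^bsub>D\<^esub> ((amap F e \<cdot>\<^bsub>D\<^esub> f2 L X \<cdot>\<^bsub>D\<^esub> (k \<otimes>\<^bsub>D\<^esub> ?X)) \<otimes>\<^bsub>D\<^esub> ?Y) \<cdot>\<^bsub>D\<^esub> ?a"
    by (simp add: D.whisker_right)
  also have "\<dots> = (amap F (\<l>\<^bsub>C\<^esub> Y) \<cdot>\<^bsub>D\<^esub> f2 \<I>\<^bsub>C\<^esub> Y \<cdot>\<^bsub>D\<^esub> (f0 \<otimes>\<^bsub>D\<^esub> ?Y)) \<cdot>\<^bsub>D\<^esub> (e' \<otimes>\<^bsub>D\<^esub> ?Y) \<cdot>\<^bsub>D\<^esub> ?a"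
    unfolding ke by (simp add: D.whisker_right)
  also have "\<dots> = D.ev_tensor M (omap F X) e' (omap F Y)"
    by (simp only: f0_lunit[OF assms(3)] D.ev_tensor_def)
  finally show ?thesis .
qed

text \<open>
  The inverse is evaluation after coevaluation, with \<open>F\<close> applied to the evaluation in \<open>C\<close>.
  Composed on one side with \<open>f2\<close> it is the image of the zigzag in \<open>C\<close>, on the other side it is the
  zigzag in \<open>D\<close>.
\<close>

lemma f2_invertible:
  assumes dual: "left_dual C X L d e" and dual': "left_dual D (omap F X) M d' e'"
    and k: "k \<in> hom D M (omap F L)"
    and kd: "f2 X L \<cdot>\<^bsub>D\<^esub> (\<one>\<^bsub>D\<^esub> (omap F X) \<otimes>\<^bsub>D\<^esub> k) \<cdot>\<^bsub>D\<^esub> d' = amap F d \<cdot>\<^bsub>D\<^esub> f0"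
    and ke: "amap F e \<cdot>\<^bsub>D\<^esub> f2 L X \<cdot>\<^bsub>D\<^esub> (k \<otimes>\<^bsub>D\<^esub> \<one>\<^bsub>D\<^esub> (omap F X)) = f0 \<cdot>\<^bsub>D\<^esub> e'"
    and Y: "Y \<in> obj C"
  shows "f2 X Y \<in> iso D (omap F X \<odot>\<^bsub>D\<^esub> omap F Y) (omap F (X \<odot>\<^bsub>C\<^esub> Y))"
proof -
  have [simp]: "X \<in> obj C" "L \<in> obj C" "Y \<in> obj C" "M \<in> obj D"
      "d \<in> arr C" "src C d = \<I>\<^bsub>C\<^esub>" "tgt C d = X \<odot>\<^bsub>C\<^esub> L"
      "e \<in> arr C" "src C e = L \<odot>\<^bsub>C\<^esub> X" "tgt C e = \<I>\<^bsub>C\<^esub>"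
      "d' \<in> arr D" "src D d' = \<I>\<^bsub>D\<^esub>" "tgt D d' = omap F X \<odot>\<^bsub>D\<^esub> M"
      "e' \<in> arr D" "src D e' = M \<odot>\<^bsub>D\<^esub> omap F X" "tgt D e' = \<I>\<^bsub>D\<^esub>"
      "k \<in> arr D" "src D k = M" "tgt D k = omap F L"
    using dual dual' k Y by (auto simp: left_dual_def hom_def)
  note [simp] = C.coev_tensor_arr D.coev_tensor_arr C.ev_tensor_arr D.ev_tensor_arr
  let ?X = "\<one>\<^bsub>D\<^esub> (omap F X)"
  let ?m = "f2 L (X \<odot>\<^bsub>C\<^esub> Y) \<cdot>\<^bsub>D\<^esub> (k \<otimes>\<^bsub>D\<^esub> \<one>\<^bsub>D\<^esub> (omap F (X \<odot>\<^bsub>C\<^esub> Y)))"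
  let ?ev = "C.ev_tensor L X e Y"
  let ?c = "D.coev_tensor (omap F X) M d'"
  let ?g = "(?X \<otimes>\<^bsub>D\<^esub> (amap F ?ev \<cdot>\<^bsub>D\<^esub> ?m)) \<cdot>\<^bsub>D\<^esub> ?c (omap F (X \<odot>\<^bsub>C\<^esub> Y))"
  have "f2 X Y \<cdot>\<^bsub>D\<^esub> ?g = (f2 X Y \<cdot>\<^bsub>D\<^esub> (?X \<otimes>\<^bsub>D\<^esub> amap F ?ev)) \<cdot>\<^bsub>D\<^esub> (?X \<otimes>\<^bsub>D\<^esub> ?m) \<cdot>\<^bsub>D\<^esub> ?c (omap F (X \<odot>\<^bsub>C\<^esub> Y))"
    by (simp add: D.whisker_left)
  also have "f2 X Y \<cdot>\<^bsub>D\<^esub> (?X \<otimes>\<^bsub>D\<^esub> amap F ?ev)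
      = amap F (\<one>\<^bsub>C\<^esub> X \<otimes>\<^bsub>C\<^esub> ?ev) \<cdot>\<^bsub>D\<^esub> f2 X (L \<odot>\<^bsub>C\<^esub> (X \<odot>\<^bsub>C\<^esub> Y))"
    using f2_natural_arr[of "\<one>\<^bsub>C\<^esub> X" ?ev] by simp
  also have "(amap F (\<one>\<^bsub>C\<^esub> X \<otimes>\<^bsub>C\<^esub> ?ev) \<cdot>\<^bsub>D\<^esub> f2 X (L \<odot>\<^bsub>C\<^esub> (X \<odot>\<^bsub>C\<^esub> Y)))
        \<cdot>\<^bsub>D\<^esub> (?X \<otimes>\<^bsub>D\<^esub> ?m) \<cdot>\<^bsub>D\<^esub> ?c (omap F (X \<odot>\<^bsub>C\<^esub> Y))
      = amap F (\<one>\<^bsub>C\<^esub> X \<otimes>\<^bsub>C\<^esub> ?ev) \<cdot>\<^bsub>D\<^esub> amap F (C.coev_tensor X L d (X \<odot>\<^bsub>C\<^esub> Y))"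
    using f2_coev_tensor[of X L "X \<odot>\<^bsub>C\<^esub> Y" d M d' k] kd by simp
  also have "\<dots> = \<one>\<^bsub>D\<^esub> (omap F (X \<odot>\<^bsub>C\<^esub> Y))"
    using C.zigzag[OF dual Y] by (simp flip: amap_cmp_arr)
  finally have right: "f2 X Y \<cdot>\<^bsub>D\<^esub> ?g = \<one>\<^bsub>D\<^esub> (omap F (X \<odot>\<^bsub>C\<^esub> Y))" .
  have "?g \<cdot>\<^bsub>D\<^esub> f2 X Y = (?X \<otimes>\<^bsub>D\<^esub> (amap F ?ev \<cdot>\<^bsub>D\<^esub> ?m)) \<cdot>\<^bsub>D\<^esub> (?X \<otimes>\<^bsub>D\<^esub> (\<one>\<^bsub>D\<^esub> M \<otimes>\<^bsub>D\<^esub> f2 X Y))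
      \<cdot>\<^bsub>D\<^esub> ?c (omap F X \<odot>\<^bsub>D\<^esub> omap F Y)"
    using D.coev_tensor_natural[of d' "omap F X" M "f2 X Y"] by simp
  also have "\<dots> = (?X \<otimes>\<^bsub>D\<^esub> (amap F ?ev \<cdot>\<^bsub>D\<^esub> f2 L (X \<odot>\<^bsub>C\<^esub> Y) \<cdot>\<^bsub>D\<^esub> (k \<otimes>\<^bsub>D\<^esub> f2 X Y)))
      \<cdot>\<^bsub>D\<^esub> ?c (omap F X \<odot>\<^bsub>D\<^esub> omap F Y)"
    by (simp add: D.tensor_cmp_ext D.tensor_cmp_arr)
  also have "\<dots> = \<one>\<^bsub>D\<^esub> (omap F X \<odot>\<^bsub>D\<^esub> omap F Y)"
    using D.zigzag[OF dual'] f2_ev_tensor[of X L Y e M e' k] ke by simp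
  finally have left: "?g \<cdot>\<^bsub>D\<^esub> f2 X Y = \<one>\<^bsub>D\<^esub> (omap F X \<odot>\<^bsub>D\<^esub> omap F Y)" .
  have "inverse_arrows D (f2 X Y) ?g"
    using left right by (simp add: inverse_arrows_def hom_def)
  then show ?thesis
    by (auto simp: iso_def hom_def)
qed

text \<open>
  The hypothesis on \<open>e\<close> and \<open>e'\<close> factors \<open>F e \<cdot> f2 \<cdot> (k \<otimes> 1)\<close> through \<open>f0\<close>. Precomposing with
  \<open>\<one> M \<otimes> f0\<close> removes \<open>f2\<close> by the right unit law, and what remains is \<open>F\<close> of the split epimorphism
  \<open>e\<close>, up to isomorphisms. The section of \<open>f0\<close> is therefore \<open>e'\<close> after those arrows.
\<close>

lemma f0_split_epi:
  assumes dual: "left_dual C \<I>\<^bsub>C\<^esub> L d e"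
    and e': "e' \<in> hom D (M \<odot>\<^bsub>D\<^esub> omap F \<I>\<^bsub>C\<^esub>) \<I>\<^bsub>D\<^esub>"
    and k: "k \<in> iso D M (omap F L)"
    and ke: "amap F e \<cdot>\<^bsub>D\<^esub> f2 L \<I>\<^bsub>C\<^esub> \<cdot>\<^bsub>D\<^esub> (k \<otimes>\<^bsub>D\<^esub> \<one>\<^bsub>D\<^esub> (omap F \<I>\<^bsub>C\<^esub>)) = f0 \<cdot>\<^bsub>D\<^esub> e'"
  obtains F0 where "F0 \<in> hom D (omap F \<I>\<^bsub>C\<^esub>) \<I>\<^bsub>D\<^esub>" and "f0 \<cdot>\<^bsub>D\<^esub> F0 = \<one>\<^bsub>D\<^esub> (omap F \<I>\<^bsub>C\<^esub>)"
proof -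
  note [simp] = D.iso_arr[OF k]
  have [simp]: "M \<in> obj D"
    using D.src_obj[of k] by simp
  have [simp]: "L \<in> obj C"
      "d \<in> arr C" "src C d = \<I>\<^bsub>C\<^esub>" "tgt C d = \<I>\<^bsub>C\<^esub> \<odot>\<^bsub>C\<^esub> L"
      "e \<in> arr C" "src C e = L \<odot>\<^bsub>C\<^esub> \<I>\<^bsub>C\<^esub>" "tgt C e = \<I>\<^bsub>C\<^esub>"
      "e' \<in> arr D" "src D e' = M \<odot>\<^bsub>D\<^esub> omap F \<I>\<^bsub>C\<^esub>" "tgt D e' = \<I>\<^bsub>D\<^esub>"
    using dual e' by (auto simp: left_dual_def hom_def)
  let ?I = "\<one>\<^bsub>D\<^esub> (omap F \<I>\<^bsub>C\<^esub>)"
  \<comment> \<open>A map \<open>FI \<rightarrow> M \<odot> I\<close>, built from the arrow \<open>\<l> L \<cdot> d : I \<rightarrow> L\<close> that splits \<open>e\<close>.\<close>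
  let ?s = "inv_arr D (\<r>\<^bsub>D\<^esub> M) \<cdot>\<^bsub>D\<^esub> inv_arr D k \<cdot>\<^bsub>D\<^esub> amap F (\<l>\<^bsub>C\<^esub> L \<cdot>\<^bsub>C\<^esub> d)"
  let ?F0 = "e' \<cdot>\<^bsub>D\<^esub> (\<one>\<^bsub>D\<^esub> M \<otimes>\<^bsub>D\<^esub> f0) \<cdot>\<^bsub>D\<^esub> ?s"
  have "f0 \<cdot>\<^bsub>D\<^esub> ?F0 = (f0 \<cdot>\<^bsub>D\<^esub> e') \<cdot>\<^bsub>D\<^esub> (\<one>\<^bsub>D\<^esub> M \<otimes>\<^bsub>D\<^esub> f0) \<cdot>\<^bsub>D\<^esub> ?s"
    by simp
  also have "\<dots> = amap F e \<cdot>\<^bsub>D\<^esub> f2 L \<I>\<^bsub>C\<^esub> \<cdot>\<^bsub>D\<^esub> (\<one>\<^bsub>D\<^esub> (omap F L) \<otimes>\<^bsub>D\<^esub> f0)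
      \<cdot>\<^bsub>D\<^esub> (k \<otimes>\<^bsub>D\<^esub> \<one>\<^bsub>D\<^esub> \<I>\<^bsub>D\<^esub>) \<cdot>\<^bsub>D\<^esub> ?s"
    unfolding ke[symmetric] by (simp add: D.tensor_cmp_ext)
  also have "(k \<otimes>\<^bsub>D\<^esub> \<one>\<^bsub>D\<^esub> \<I>\<^bsub>D\<^esub>) \<cdot>\<^bsub>D\<^esub> ?s = inv_arr D (\<r>\<^bsub>D\<^esub> (omap F L)) \<cdot>\<^bsub>D\<^esub> amap F (\<l>\<^bsub>C\<^esub> L \<cdot>\<^bsub>C\<^esub> d)"
    using D.square_tail[OF D.inv_runit_natural_arr[of k, symmetric],
        of "inv_arr D k \<cdot>\<^bsub>D\<^esub> amap F (\<l>\<^bsub>C\<^esub> L \<cdot>\<^bsub>C\<^esub> d)"] D.iso_cancel[OF k] by simp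
  also have "amap F e \<cdot>\<^bsub>D\<^esub> f2 L \<I>\<^bsub>C\<^esub> \<cdot>\<^bsub>D\<^esub> (\<one>\<^bsub>D\<^esub> (omap F L) \<otimes>\<^bsub>D\<^esub> f0)
      \<cdot>\<^bsub>D\<^esub> inv_arr D (\<r>\<^bsub>D\<^esub> (omap F L)) \<cdot>\<^bsub>D\<^esub> amap F (\<l>\<^bsub>C\<^esub> L \<cdot>\<^bsub>C\<^esub> d)
    = amap F e \<cdot>\<^bsub>D\<^esub> (f2 L \<I>\<^bsub>C\<^esub> \<cdot>\<^bsub>D\<^esub> (\<one>\<^bsub>D\<^esub> (omap F L) \<otimes>\<^bsub>D\<^esub> f0)
      \<cdot>\<^bsub>D\<^esub> inv_arr D (\<r>\<^bsub>D\<^esub> (omap F L))) \<cdot>\<^bsub>D\<^esub> amap F (\<l>\<^bsub>C\<^esub> L \<cdot>\<^bsub>C\<^esub> d)"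
    by simp
  also have "\<dots> = amap F (e \<cdot>\<^bsub>C\<^esub> inv_arr C (\<r>\<^bsub>C\<^esub> L) \<cdot>\<^bsub>C\<^esub> \<l>\<^bsub>C\<^esub> L \<cdot>\<^bsub>C\<^esub> d)"
    by (simp add: f2_unit_right amap_cmp_arr)
  also have "\<dots> = ?I"
    by (simp add: C.unit_dual_retract[OF dual])
  finally show ?thesis
    by (intro that[of ?F0]) (simp_all add: hom_def)
qed

section \<open>Inverting the monoidal structure\<close>

text \<open>
  With \<open>f2\<close> invertible, each Frobenius equation is the associativity axiom with \<open>f2\<close> moved across
  by its inverse, and coassociativity is the second Frobenius equation with one more \<open>f2\<close>
  cancelled. In the counit laws the unit laws turn \<open>\<l>\<close> and \<open>\<r>\<close> of \<open>D\<close> into composites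
  ending in \<open>f0\<close>, which then meets \<open>F0\<close>.
\<close>

lemma frobenius_of_invertible:
  assumes inv: "\<And>X Y. \<lbrakk>X \<in> obj C; Y \<in> obj C\<rbrakk>
      \<Longrightarrow> f2 X Y \<in> iso D (omap F X \<odot>\<^bsub>D\<^esub> omap F Y) (omap F (X \<odot>\<^bsub>C\<^esub> Y))"
    and F0: "F0 \<in> hom D (omap F \<I>\<^bsub>C\<^esub>) \<I>\<^bsub>D\<^esub>" and sec: "f0 \<cdot>\<^bsub>D\<^esub> F0 = \<one>\<^bsub>D\<^esub> (omap F \<I>\<^bsub>C\<^esub>)"
  shows "frobenius_monoidal_functor C D F f2 f0 (\<lambda>X Y. inv_arr D (f2 X Y)) F0"
proof -
  note [simp] = D.iso_arr[OF inv] D.iso_cancel[OF inv]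
  have [simp]: "F0 \<in> arr D" "src D F0 = omap F \<I>\<^bsub>C\<^esub>" "tgt D F0 = \<I>\<^bsub>D\<^esub>"
    using F0 by (auto simp: hom_def)
  let ?F2 = "\<lambda>X Y. inv_arr D (f2 X Y)"
  let ?F = "\<lambda>X. \<one>\<^bsub>D\<^esub> (omap F X)"
  have f2F2_right: "(f2 X Y \<otimes>\<^bsub>D\<^esub> ?F Z) \<cdot>\<^bsub>D\<^esub> (?F2 X Y \<otimes>\<^bsub>D\<^esub> ?F Z) = \<one>\<^bsub>D\<^esub> (omap F (X \<odot>\<^bsub>C\<^esub> Y) \<odot>\<^bsub>D\<^esub> omap F Z)"
    and F2f2_left: "(?F X \<otimes>\<^bsub>D\<^esub> ?F2 Y Z) \<cdot>\<^bsub>D\<^esub> (?F X \<otimes>\<^bsub>D\<^esub> f2 Y Z) = \<one>\<^bsub>D\<^esub> (omap F X \<odot>\<^bsub>D\<^esub> omap F Y \<odot>\<^bsub>D\<^esub> omap F Z)"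
    and f2F2_left: "(?F X \<otimes>\<^bsub>D\<^esub> f2 Y Z) \<cdot>\<^bsub>D\<^esub> (?F X \<otimes>\<^bsub>D\<^esub> ?F2 Y Z) = \<one>\<^bsub>D\<^esub> (omap F X \<odot>\<^bsub>D\<^esub> omap F (Y \<odot>\<^bsub>C\<^esub> Z))"
    if "X \<in> obj C" "Y \<in> obj C" "Z \<in> obj C" for X Y Z
    using that by (simp_all add: D.tensor_cmp_arr)
  have frob_left: "?F2 (X \<odot>\<^bsub>C\<^esub> Y) Z \<cdot>\<^bsub>D\<^esub> amap F (inv_arr C (\<alpha>\<^bsub>C\<^esub> X Y Z)) \<cdot>\<^bsub>D\<^esub> f2 X (Y \<odot>\<^bsub>C\<^esub> Z)
      = (f2 X Y \<otimes>\<^bsub>D\<^esub> ?F Z) \<cdot>\<^bsub>D\<^esub> inv_arr D (\<alpha>\<^bsub>D\<^esub> (omap F X) (omap F Y) (omap F Z))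
        \<cdot>\<^bsub>D\<^esub> (?F X \<otimes>\<^bsub>D\<^esub> ?F2 Y Z)"
    if [simp]: "X \<in> obj C" "Y \<in> obj C" "Z \<in> obj C" for X Y Z
  proof -
    have "?F2 (X \<odot>\<^bsub>C\<^esub> Y) Z \<cdot>\<^bsub>D\<^esub> amap F (inv_arr C (\<alpha>\<^bsub>C\<^esub> X Y Z)) \<cdot>\<^bsub>D\<^esub> f2 X (Y \<odot>\<^bsub>C\<^esub> Z)
        = ?F2 (X \<odot>\<^bsub>C\<^esub> Y) Z \<cdot>\<^bsub>D\<^esub> (amap F (inv_arr C (\<alpha>\<^bsub>C\<^esub> X Y Z)) \<cdot>\<^bsub>D\<^esub> f2 X (Y \<odot>\<^bsub>C\<^esub> Z)
          \<cdot>\<^bsub>D\<^esub> (?F X \<otimes>\<^bsub>D\<^esub> f2 Y Z)) \<cdot>\<^bsub>D\<^esub> (?F X \<otimes>\<^bsub>D\<^esub> ?F2 Y Z)"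
      by (simp add: f2F2_left)
    then show ?thesis
      unfolding f2_inv_assoc[OF that] by simp
  qed
  have frob_right: "?F2 X (Y \<odot>\<^bsub>C\<^esub> Z) \<cdot>\<^bsub>D\<^esub> amap F (\<alpha>\<^bsub>C\<^esub> X Y Z) \<cdot>\<^bsub>D\<^esub> f2 (X \<odot>\<^bsub>C\<^esub> Y) Z
      = (?F X \<otimes>\<^bsub>D\<^esub> f2 Y Z) \<cdot>\<^bsub>D\<^esub> \<alpha>\<^bsub>D\<^esub> (omap F X) (omap F Y) (omap F Z) \<cdot>\<^bsub>D\<^esub> (?F2 X Y \<otimes>\<^bsub>D\<^esub> ?F Z)"
    if [simp]: "X \<in> obj C" "Y \<in> obj C" "Z \<in> obj C" for X Y Z
  proof -
    have "?F2 X (Y \<odot>\<^bsub>C\<^esub> Z) \<cdot>\<^bsub>D\<^esub> amap F (\<alpha>\<^bsub>C\<^esub> X Y Z) \<cdot>\<^bsub>D\<^esub> f2 (X \<odot>\<^bsub>C\<^esub> Y) Z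
        = ?F2 X (Y \<odot>\<^bsub>C\<^esub> Z) \<cdot>\<^bsub>D\<^esub> (amap F (\<alpha>\<^bsub>C\<^esub> X Y Z) \<cdot>\<^bsub>D\<^esub> f2 (X \<odot>\<^bsub>C\<^esub> Y) Z
          \<cdot>\<^bsub>D\<^esub> (f2 X Y \<otimes>\<^bsub>D\<^esub> ?F Z)) \<cdot>\<^bsub>D\<^esub> (?F2 X Y \<otimes>\<^bsub>D\<^esub> ?F Z)"
      by (simp add: f2F2_right)
    then show ?thesis
      unfolding f2_assoc[OF that] by simp
  qed
  have F2_hom: "?F2 X Y \<in> hom D (omap F (X \<odot>\<^bsub>C\<^esub> Y)) (omap F X \<odot>\<^bsub>D\<^esub> omap F Y)"
    if "X \<in> obj C" "Y \<in> obj C" for X Y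
    using that by (simp add: hom_def)
  have natural: "?F2 X' Y' \<cdot>\<^bsub>D\<^esub> amap F (f \<otimes>\<^bsub>C\<^esub> g) = (amap F f \<otimes>\<^bsub>D\<^esub> amap F g) \<cdot>\<^bsub>D\<^esub> ?F2 X Y"
    if "f \<in> hom C X X'" "g \<in> hom C Y Y'" for f g X X' Y Y'
  proof -
    have [simp]: "f \<in> arr C" "src C f = X" "tgt C f = X'" "g \<in> arr C" "src C g = Y" "tgt C g = Y'"
      using that by (auto simp: hom_def)
    have [simp]: "X \<in> obj C" "X' \<in> obj C" "Y \<in> obj C" "Y' \<in> obj C"
      using C.src_obj[of f] C.tgt_obj[of f] C.src_obj[of g] C.tgt_obj[of g] by simp_all
    have "?F2 X' Y' \<cdot>\<^bsub>D\<^esub> amap F (f \<otimes>\<^bsub>C\<^esub> g)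
        = ?F2 X' Y' \<cdot>\<^bsub>D\<^esub> (amap F (f \<otimes>\<^bsub>C\<^esub> g) \<cdot>\<^bsub>D\<^esub> f2 X Y) \<cdot>\<^bsub>D\<^esub> ?F2 X Y"
      by simp
    then show ?thesis
      unfolding f2_natural[OF that, symmetric] by simp
  qed
  have coassoc: "\<alpha>\<^bsub>D\<^esub> (omap F X) (omap F Y) (omap F Z) \<cdot>\<^bsub>D\<^esub> (?F2 X Y \<otimes>\<^bsub>D\<^esub> ?F Z) \<cdot>\<^bsub>D\<^esub> ?F2 (X \<odot>\<^bsub>C\<^esub> Y) Z
      = (?F X \<otimes>\<^bsub>D\<^esub> ?F2 Y Z) \<cdot>\<^bsub>D\<^esub> ?F2 X (Y \<odot>\<^bsub>C\<^esub> Z) \<cdot>\<^bsub>D\<^esub> amap F (\<alpha>\<^bsub>C\<^esub> X Y Z)"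
    if [simp]: "X \<in> obj C" "Y \<in> obj C" "Z \<in> obj C" for X Y Z
  proof -
    have "(?F X \<otimes>\<^bsub>D\<^esub> ?F2 Y Z) \<cdot>\<^bsub>D\<^esub> ?F2 X (Y \<odot>\<^bsub>C\<^esub> Z) \<cdot>\<^bsub>D\<^esub> amap F (\<alpha>\<^bsub>C\<^esub> X Y Z)
        = (?F X \<otimes>\<^bsub>D\<^esub> ?F2 Y Z) \<cdot>\<^bsub>D\<^esub> (?F2 X (Y \<odot>\<^bsub>C\<^esub> Z) \<cdot>\<^bsub>D\<^esub> amap F (\<alpha>\<^bsub>C\<^esub> X Y Z) \<cdot>\<^bsub>D\<^esub> f2 (X \<odot>\<^bsub>C\<^esub> Y) Z)
          \<cdot>\<^bsub>D\<^esub> ?F2 (X \<odot>\<^bsub>C\<^esub> Y) Z"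
      by simp
    then show ?thesis
      unfolding frob_right[OF that] by (simp add: D.cmp_eq_tail[OF F2f2_left])
  qed
  have lcounit: "\<l>\<^bsub>D\<^esub> (omap F X) \<cdot>\<^bsub>D\<^esub> (F0 \<otimes>\<^bsub>D\<^esub> ?F X) \<cdot>\<^bsub>D\<^esub> ?F2 \<I>\<^bsub>C\<^esub> X = amap F (\<l>\<^bsub>C\<^esub> X)"
    if [simp]: "X \<in> obj C" for X
    unfolding f0_lunit[OF that, symmetric] by (simp add: D.tensor_cmp_ext sec)
  have rcounit: "\<r>\<^bsub>D\<^esub> (omap F X) \<cdot>\<^bsub>D\<^esub> (?F X \<otimes>\<^bsub>D\<^esub> F0) \<cdot>\<^bsub>D\<^esub> ?F2 X \<I>\<^bsub>C\<^esub> = amap F (\<r>\<^bsub>C\<^esub> X)"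
    if [simp]: "X \<in> obj C" for X
    unfolding f0_runit[OF that, symmetric] by (simp add: D.tensor_cmp_ext sec)
  show ?thesis
    by unfold_locales
      (fact F2_hom natural F0 coassoc lcounit rcounit frob_left frob_right)+
qed

end

theorem theorem12:
  fixes C :: "('o, 'm) autonomous_category"
    and D :: "('p, 'n) autonomous_category"
    and F :: "('o, 'm, 'p, 'n) cat_functor"
    and f2 :: "'o \<Rightarrow> 'o \<Rightarrow> 'n" and f0 :: 'n
    and \<kappa> :: "'o \<Rightarrow> 'n"
  assumes "autonomous_category C" and "autonomous_category D"
    and "autonomous_functor C D F f2 f0 \<kappa>"
  shows "\<exists>F2 F0. frobenius_monoidal_functor C D F f2 f0 F2 F0"
proof -
  interpret autonomous_functor C D F f2 f0 \<kappa>
    by (fact assms(3))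
  have "f2 X Y \<in> iso D (omap F X \<odot>\<^bsub>D\<^esub> omap F Y) (omap F (X \<odot>\<^bsub>C\<^esub> Y))"
    if X: "X \<in> obj C" and Y: "Y \<in> obj C" for X Y
  proof (rule f2_invertible[OF C.left_dual[OF X] D.left_dual _ kappa_d[OF X] kappa_e[OF X] Y])
    show "omap F X \<in> obj D"
      using X by simp
    show "\<kappa> X \<in> hom D (ldual D (omap F X)) (omap F (ldual C X))"
      using kappa_iso[OF X] by (simp add: iso_def)
  qed
  moreover have I: "\<I>\<^bsub>C\<^esub> \<in> obj C"
    by simp
  have "ldual_e D (omap F \<I>\<^bsub>C\<^esub>) \<in> hom D (ldual D (omap F \<I>\<^bsub>C\<^esub>) \<odot>\<^bsub>D\<^esub> omap F \<I>\<^bsub>C\<^esub>) \<I>\<^bsub>D\<^esub>"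
    using D.left_dual[OF omap_obj[OF I]] by (simp add: left_dual_def)
  from f0_split_epi[OF C.left_dual[OF I] this kappa_iso[OF I] kappa_e[OF I]]
  obtain F0 where "F0 \<in> hom D (omap F \<I>\<^bsub>C\<^esub>) \<I>\<^bsub>D\<^esub>" and "f0 \<cdot>\<^bsub>D\<^esub> F0 = \<one>\<^bsub>D\<^esub> (omap F \<I>\<^bsub>C\<^esub>)" .
  ultimately have "frobenius_monoidal_functor C D F f2 f0 (\<lambda>X Y. inv_arr D (f2 X Y)) F0"
    by (rule frobenius_of_invertible)
  then show ?thesis
    by blast
qed

end
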